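(* Let $f:\omega\to\omega$ be not generically computable and let $X\subseteq\omega$ be $1$-generic relative to $f$. Then there is no partial $X$-computable generic description of $f$. Consequently, for every set $A\subseteq\omega$ that is not generically computable, the classes $\{X: A\le_{\mathrm{ug}} X\}$ and $\{X: A\le_{\mathrm{ng}} X\}$ are meager.
   Context: For $C\subseteq\omega$, $\rho_n(C)=|C\cap\{0,\dots,n-1\}|/n$ and $\rho(C)=\lim_n\rho_n(C)$ when it exists. A generic description of $g$ is a partial function $d$ with $d(n)=g(n)$ for all $n\in\mathrm{dom}\,d$ and $\rho(\mathrm{dom}\,d)=1$; $g$ is generically computable if it has a partial computable generic description. $X$ is $1$-generic relative to $f$ if for every $f$-c.e. set $S$ of finite binary strings, either some initial segment of $X$ lies in $S$, or some initial segment of $X$ has no extension in $S$. An enumeration operator is a c.e. set $W$ of pairs $(F,k)$, $F$ finite, with $W^Y=\{k:\exists(F,k)\in W,\,F\subseteq Y\}$. $h\le_{\mathrm{ng}} g$: every generic description $d$ of $g$ has a generic description $e$ of $h$ with $\mathrm{gra}(e)=W^{\mathrm{gra}(d)}$ for some enumeration operator $W$; $h\le_{\mathrm{ug}} g$: a single enumeration operator $W$ works for all generic descriptions $d$ of $g$. Sets are identified with characteristic functions; meagerness is in the Cantor space topology on $2^\omega$. *)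

theory Defs
  imports
    "HOL-Analysis.Analysis"
    "HOL-Library.Nat_Bijection"
    "HOL-Library.Sublist"
begin

text \<open>
  Relative computability is Kleene's: the partial functions recursive in an oracle
  \<open>g\<close> are those obtained from zero, successor, projections and \<open>g\<close> itself
  by composition, primitive recursion and unbounded minimisation. Arities are not part of
  the syntax: zero and the projections exist at every arity, and an initial function applied
  to an argument list it does not fit is undefined.
\<close>

datatype recfn =
    Zero
  | Succ
  | Oracle
  | Proj nat
  | Comp recfn "recfn list"
  | PrimRec recfn recfn
  | Minim recfn

fun run :: "(nat \<Rightarrow> nat) \<Rightarrow> recfn \<Rightarrow> nat list \<Rightarrow> nat option" where
  "run g Zero xs = Some 0"
| "run g Succ xs = (case xs of [x] \<Rightarrow> Some (Suc x) | _ \<Rightarrow> None)"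
| "run g Oracle xs = (case xs of [x] \<Rightarrow> Some (g x) | _ \<Rightarrow> None)"
| "run g (Proj i) xs = (if i < length xs then Some (xs ! i) else None)"
| "run g (Comp p qs) xs =
     (if \<forall>q \<in> set qs. run g q xs \<noteq> None
      then run g p (map (\<lambda>q. the (run g q xs)) qs) else None)"
| "run g (PrimRec b s) xs =
     (case xs of
        [] \<Rightarrow> None
      | n # ys \<Rightarrow>
          rec_nat (run g b ys)
            (\<lambda>m r. case r of None \<Rightarrow> None | Some v \<Rightarrow> run g s (m # v # ys)) n)"
| "run g (Minim p) xs =
     (if \<exists>n. run g p (n # xs) = Some 0 \<and> (\<forall>m<n. \<exists>v. run g p (m # xs) = Some (Suc v))
      then Some (LEAST n. run g p (n # xs) = Some 0) else None)"

definition partial_computable_in :: "(nat \<Rightarrow> nat) \<Rightarrow> (nat \<rightharpoonup> nat) \<Rightarrow> bool" where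
  "partial_computable_in g d \<longleftrightarrow> (\<exists>p. \<forall>n. d n = run g p [n])"

text \<open>With the zero function as oracle, \<^const>\<open>Oracle\<close> adds nothing to the other
  initial functions, so this is absolute computability.\<close>

definition partial_computable :: "(nat \<rightharpoonup> nat) \<Rightarrow> bool" where
  "partial_computable d \<longleftrightarrow> partial_computable_in (\<lambda>_. 0) d"

definition ce_in :: "(nat \<Rightarrow> nat) \<Rightarrow> nat set \<Rightarrow> bool" where
  "ce_in g S \<longleftrightarrow> (\<exists>d. partial_computable_in g d \<and> S = dom d)"

definition ce :: "nat set \<Rightarrow> bool" where
  "ce S \<longleftrightarrow> (\<exists>d. partial_computable d \<and> S = dom d)"

definition char_fun :: "nat set \<Rightarrow> nat \<Rightarrow> nat" where
  "char_fun X n = (if n \<in> X then 1 else 0)"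

definition initial_density :: "nat \<Rightarrow> nat set \<Rightarrow> real" where
  "initial_density n C = real (card (C \<inter> {..<n})) / real n"

definition has_density :: "nat set \<Rightarrow> real \<Rightarrow> bool" where
  "has_density C r \<longleftrightarrow> (\<lambda>n. initial_density n C) \<longlonglongrightarrow> r"

definition generic_description :: "(nat \<rightharpoonup> nat) \<Rightarrow> (nat \<Rightarrow> nat) \<Rightarrow> bool" where
  "generic_description d g \<longleftrightarrow> (\<forall>n \<in> dom d. d n = Some (g n)) \<and> has_density (dom d) 1"

definition generically_computable :: "(nat \<Rightarrow> nat) \<Rightarrow> bool" where
  "generically_computable g \<longleftrightarrow> (\<exists>d. partial_computable d \<and> generic_description d g)"

definition string_code :: "bool list \<Rightarrow> nat" where
  "string_code s = list_encode (map of_bool s)"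

definition ce_strings_in :: "(nat \<Rightarrow> nat) \<Rightarrow> bool list set \<Rightarrow> bool" where
  "ce_strings_in g S \<longleftrightarrow> ce_in g (string_code ` S)"

definition initial_segment :: "nat set \<Rightarrow> nat \<Rightarrow> bool list" where
  "initial_segment X n = map (\<lambda>i. i \<in> X) [0..<n]"

definition one_generic_in :: "(nat \<Rightarrow> nat) \<Rightarrow> nat set \<Rightarrow> bool" where
  "one_generic_in f X \<longleftrightarrow>
     (\<forall>S. ce_strings_in f S \<longrightarrow>
        (\<exists>n. initial_segment X n \<in> S) \<or>
        (\<exists>n. \<not> (\<exists>t \<in> S. prefix (initial_segment X n) t)))"

text \<open>Finite sets are coded by their canonical indices.\<close>

definition enumeration_operator :: "(nat set \<times> nat) set \<Rightarrow> bool" where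
  "enumeration_operator W \<longleftrightarrow>
     (\<forall>(F, k) \<in> W. finite F) \<and> ce ((\<lambda>(F, k). prod_encode (set_encode F, k)) ` W)"

definition enum_apply :: "(nat set \<times> nat) set \<Rightarrow> nat set \<Rightarrow> nat set" where
  "enum_apply W Y = {k. \<exists>F. (F, k) \<in> W \<and> F \<subseteq> Y}"

definition gra :: "(nat \<rightharpoonup> nat) \<Rightarrow> nat set" where
  "gra d = {prod_encode (n, y) | n y. d n = Some y}"

definition ng_reducible :: "(nat \<Rightarrow> nat) \<Rightarrow> (nat \<Rightarrow> nat) \<Rightarrow> bool" (infix "\<le>\<^sub>n\<^sub>g" 50) where
  "h \<le>\<^sub>n\<^sub>g g \<longleftrightarrow>
     (\<forall>d. generic_description d g \<longrightarrow>
        (\<exists>e W. generic_description e h \<and> enumeration_operator W \<and> gra e = enum_apply W (gra d)))"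

definition ug_reducible :: "(nat \<Rightarrow> nat) \<Rightarrow> (nat \<Rightarrow> nat) \<Rightarrow> bool" (infix "\<le>\<^sub>u\<^sub>g" 50) where
  "h \<le>\<^sub>u\<^sub>g g \<longleftrightarrow>
     (\<exists>W. enumeration_operator W \<and>
        (\<forall>d. generic_description d g \<longrightarrow>
           (\<exists>e. generic_description e h \<and> gra e = enum_apply W (gra d))))"

text \<open>The topology of \<open>2\<^sup>\<omega>\<close>, carried over to subsets of \<open>\<omega>\<close>
  along \<open>X \<mapsto> (\<lambda>n. n \<in> X)\<close>.\<close>

definition cantor_space :: "nat set topology" where
  "cantor_space =
     pullback_topology UNIV (\<lambda>X n. n \<in> X) (product_topology (\<lambda>_. discrete_topology UNIV) UNIV)"

definition nowhere_dense_in :: "'a topology \<Rightarrow> 'a set \<Rightarrow> bool" where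
  "nowhere_dense_in T S \<longleftrightarrow> S \<subseteq> topspace T \<and> T interior_of (T closure_of S) = {}"

definition meager_in :: "'a topology \<Rightarrow> 'a set \<Rightarrow> bool" where
  "meager_in T S \<longleftrightarrow> (\<exists>U :: nat \<Rightarrow> 'a set. (\<forall>i. nowhere_dense_in T (U i)) \<and> S = (\<Union>i. U i))"

end

theory Submission
  imports Defs
begin

text \<open>
  Suppose the program \<open>p\<close> with oracle \<open>X\<close> computes a generic description of \<open>f\<close>. The strings
  on which \<open>p\<close> gives an answer that disagrees with \<open>f\<close> form an \<open>f\<close>-c.e. set containing no
  initial segment of \<open>X\<close>, so by 1-genericity some initial segment \<open>s\<close> of \<open>X\<close> has no extension
  in it. Answering \<open>n\<close> by the first answer of \<open>p\<close> found on an extension of \<open>s\<close> is then always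
  correct, and possible wherever \<open>p\<close> with oracle \<open>X\<close> converges, so \<open>f\<close> is generically
  computable.

  The characteristic function of \<open>X\<close> is a generic description of itself, and a partial function
  is computable in \<open>X\<close> iff its graph is c.e. in \<open>X\<close>. Hence if \<open>A\<close> is non-uniformly generically
  reducible to \<open>X\<close>, then \<open>A\<close> has a generic description computable in \<open>X\<close>, and \<open>X\<close> is not
  1-generic relative to \<open>A\<close> unless \<open>A\<close> is generically computable. The \<open>X\<close> at which 1-genericity
  fails for a given set \<open>S\<close> of strings lie on the frontier of the open class of all \<open>X\<close> with an
  initial segment in \<open>S\<close>. Such a frontier is nowhere dense, and only countably many \<open>S\<close> are
  c.e. in \<open>A\<close>.
\<close>

section \<open>Total recursive functions\<close>

text \<open>
  A function of finitely many natural numbers is taken as a function of an assignment \<open>e\<close> of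
  values to all variables \<open>0, 1, \<dots>\<close>, so that arities need not be tracked. A rule for an
  operator that binds a variable makes it variable \<open>0\<close> and shifts the others up.
\<close>

definition total_recursive :: "(nat \<Rightarrow> nat) \<Rightarrow> ((nat \<Rightarrow> nat) \<Rightarrow> nat) \<Rightarrow> bool" where
  "total_recursive g F \<longleftrightarrow>
     (\<exists>p. \<forall>\<^sub>F n in sequentially. \<forall>e. run g p (map e [0..<n]) = Some (F e))"

abbreviation (input) shift :: "(nat \<Rightarrow> nat) \<Rightarrow> nat \<Rightarrow> nat" where
  "shift e \<equiv> \<lambda>i. e (Suc i)"

named_theorems recursive_intros

lemma total_recursive_subst:
  assumes H: "total_recursive g H" and F: "\<And>i. total_recursive g (F i)"
  shows "total_recursive g (\<lambda>e. H (\<lambda>i. F i e))"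
proof -
  obtain p where "\<forall>\<^sub>F n in sequentially. \<forall>e. run g p (map e [0..<n]) = Some (H e)"
    using H unfolding total_recursive_def by blast
  from eventually_happens'[OF sequentially_bot this]
  obtain k where p: "\<forall>e. run g p (map e [0..<k]) = Some (H e)" ..
  have "\<forall>i. \<exists>q. \<forall>\<^sub>F n in sequentially. \<forall>e. run g q (map e [0..<n]) = Some (F i e)"
    using F unfolding total_recursive_def by simp
  from choice[OF this] obtain q
    where q: "\<forall>i. \<forall>\<^sub>F n in sequentially. \<forall>e. run g (q i) (map e [0..<n]) = Some (F i e)" ..
  have "\<forall>\<^sub>F n in sequentially. \<forall>i\<in>{..<k}. \<forall>e. run g (q i) (map e [0..<n]) = Some (F i e)"
    by (intro eventually_ball_finite ballI q[rule_format]) simp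
  then have "\<forall>\<^sub>F n in sequentially. \<forall>e.
      run g (Comp p (map q [0..<k])) (map e [0..<n]) = Some (H (\<lambda>i. F i e))"
  proof eventually_elim
    case (elim n)
    have "map (\<lambda>r. the (run g r (map e [0..<n]))) (map q [0..<k]) = map (\<lambda>i. F i e) [0..<k]" for e
      using elim by simp
    then show ?case using elim p by (simp del: map_map map_eq_conv)
  qed
  then show ?thesis unfolding total_recursive_def by blast
qed

lemma total_recursive_proj [recursive_intros]: "total_recursive g (\<lambda>e. e i)"
  unfolding total_recursive_def
  by (intro exI[of _ "Proj i"] eventually_sequentiallyI[of "Suc i"]) simp

lemma total_recursive_comp1:
  assumes "total_recursive g (\<lambda>e. H (e 0))" and "total_recursive g A"
  shows "total_recursive g (\<lambda>e. H (A e))"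
  using total_recursive_subst[OF assms(1), of "\<lambda>_. A"] assms(2) by simp

lemma total_recursive_comp2:
  assumes "total_recursive g (\<lambda>e. H (e 0) (e 1))"
    and "total_recursive g A" and "total_recursive g B"
  shows "total_recursive g (\<lambda>e. H (A e) (B e))"
  using total_recursive_subst[OF assms(1), of "case_nat A (\<lambda>_. B)"] assms(2,3)
  by (simp split: nat.split)

lemma total_recursive_shift:
  "total_recursive g A \<Longrightarrow> total_recursive g (\<lambda>e. A (shift e))"
  by (rule total_recursive_subst[where F = "\<lambda>i e. e (Suc i)"]) (auto intro: recursive_intros)

lemma total_recursive_initial_function:
  assumes "\<And>x. run g p [x] = Some (H x)" and "total_recursive g A"
  shows "total_recursive g (\<lambda>e. H (A e))"
proof (rule total_recursive_comp1[OF _ assms(2)])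
  show "total_recursive g (\<lambda>e. H (e 0))"
    unfolding total_recursive_def
    by (intro exI[of _ "Comp p [Proj 0]"] eventually_sequentiallyI[of 1]) (simp add: assms(1))
qed

lemma total_recursive_Suc [recursive_intros]:
  "total_recursive g A \<Longrightarrow> total_recursive g (\<lambda>e. Suc (A e))"
  by (rule total_recursive_initial_function[of g Succ]) simp_all

lemma total_recursive_oracle:
  "total_recursive g A \<Longrightarrow> total_recursive g (\<lambda>e. g (A e))"
  by (rule total_recursive_initial_function[of g Oracle]) simp_all

lemma total_recursive_const [recursive_intros]: "total_recursive g (\<lambda>e. c)"
proof (induction c)
  case 0
  show ?case unfolding total_recursive_def by (rule exI[of _ Zero]) simp
next
  case (Suc c)
  then show ?case by (rule total_recursive_Suc)
qed

lemma total_recursive_rec_nat: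
  assumes N: "total_recursive g N" and B: "total_recursive g B"
    and S: "total_recursive g (\<lambda>e. S (e 0) (e 1) (shift (shift e)))"
  shows "total_recursive g (\<lambda>e. rec_nat (B e) (\<lambda>m r. S m r e) (N e))"
proof -
  let ?H = "\<lambda>e. rec_nat (B (shift e)) (\<lambda>m r. S m r (shift e)) (e 0)"
  obtain b where b: "\<forall>\<^sub>F n in sequentially. \<forall>e. run g b (map e [0..<n]) = Some (B e)"
    using B unfolding total_recursive_def by blast
  obtain s where "\<forall>\<^sub>F n in sequentially. \<forall>e.
      run g s (map e [0..<n]) = Some (S (e 0) (e 1) (shift (shift e)))"
    using S unfolding total_recursive_def by blast
  from sequentially_offset[OF this, of 2] b
  have "\<forall>\<^sub>F n in sequentially. \<forall>e. run g (PrimRec b s) (map e [0..<Suc n]) = Some (?H e)"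
  proof eventually_elim
    case (elim n)
    have "run g s (m # r # map e [0..<n]) = Some (S m r e)" for m r e
      using elim(1)[rule_format, of "case_nat m (case_nat r e)"]
      by (simp add: map_upt_Suc del: upt_Suc)
    then have "run g (PrimRec b s) (x # map e [0..<n]) =
        Some (rec_nat (B e) (\<lambda>m r. S m r e) x)" for x e
      using elim(2) by (induction x) auto
    then show ?case by (simp add: map_upt_Suc del: upt_Suc run.simps)
  qed
  then have "total_recursive g ?H"
    unfolding total_recursive_def
    using eventually_sequentially_Suc
      [of "\<lambda>n. \<forall>e. run g (PrimRec b s) (map e [0..<n]) = Some (?H e)"] by blast
  from total_recursive_subst[OF this, of "case_nat N (\<lambda>i e. e i)"] show ?thesis
    using N by (simp add: total_recursive_proj split: nat.split)
qed

lemma total_recursive_add [recursive_intros]: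
  assumes "total_recursive g A" and "total_recursive g B"
  shows "total_recursive g (\<lambda>e. A e + B e)"
proof (rule total_recursive_comp2[OF _ assms])
  have "rec_nat a (\<lambda>_ r. Suc r) b = a + b" for a b by (induction b) auto
  moreover have "total_recursive g (\<lambda>e. rec_nat (e 0) (\<lambda>_ r. Suc r) (e 1))"
    by (intro total_recursive_rec_nat recursive_intros)
  ultimately show "total_recursive g (\<lambda>e. e 0 + e 1)" by simp
qed

lemma total_recursive_mult [recursive_intros]:
  assumes "total_recursive g A" and "total_recursive g B"
  shows "total_recursive g (\<lambda>e. A e * B e)"
proof (rule total_recursive_comp2[OF _ assms])
  have "rec_nat 0 (\<lambda>_ r. r + a) b = a * b" for a b :: nat by (induction b) auto
  moreover have "total_recursive g (\<lambda>e. rec_nat 0 (\<lambda>_ r. r + e 0) (e 1))"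
    by (intro total_recursive_rec_nat recursive_intros)
  ultimately show "total_recursive g (\<lambda>e. e 0 * e 1)" by simp
qed

lemma total_recursive_power [recursive_intros]:
  assumes "total_recursive g A" and "total_recursive g B"
  shows "total_recursive g (\<lambda>e. A e ^ B e)"
proof (rule total_recursive_comp2[OF _ assms])
  have "rec_nat 1 (\<lambda>_ r. r * a) b = a ^ b" for a b :: nat by (induction b) auto
  moreover have "total_recursive g (\<lambda>e. rec_nat 1 (\<lambda>_ r. r * e 0) (e 1))"
    by (intro total_recursive_rec_nat recursive_intros)
  ultimately show "total_recursive g (\<lambda>e. e 0 ^ e 1)" by simp
qed

lemma total_recursive_pred:
  assumes "total_recursive g A"
  shows "total_recursive g (\<lambda>e. A e - 1)"
proof (rule total_recursive_comp1[OF _ assms])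
  have "rec_nat 0 (\<lambda>m _. m) a = a - 1" for a by (cases a) auto
  moreover have "total_recursive g (\<lambda>e. rec_nat 0 (\<lambda>m _. m) (e 0))"
    by (intro total_recursive_rec_nat recursive_intros)
  ultimately show "total_recursive g (\<lambda>e. e 0 - 1)" by simp
qed

lemma total_recursive_diff [recursive_intros]:
  assumes "total_recursive g A" and "total_recursive g B"
  shows "total_recursive g (\<lambda>e. A e - B e)"
proof (rule total_recursive_comp2[OF _ assms])
  have "rec_nat a (\<lambda>_ r. r - 1) b = a - b" for a b :: nat by (induction b) auto
  moreover have "total_recursive g (\<lambda>e. rec_nat (e 0) (\<lambda>_ r. r - 1) (e 1))"
    by (intro total_recursive_rec_nat total_recursive_pred recursive_intros)
  ultimately show "total_recursive g (\<lambda>e. e 0 - e 1)" by simp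
qed

section \<open>Decidable predicates\<close>

definition decidable_in :: "(nat \<Rightarrow> nat) \<Rightarrow> ((nat \<Rightarrow> nat) \<Rightarrow> bool) \<Rightarrow> bool" where
  "decidable_in g P \<longleftrightarrow> total_recursive g (\<lambda>e. of_bool (P e))"

lemma total_recursive_of_bool [recursive_intros]:
  "decidable_in g P \<Longrightarrow> total_recursive g (\<lambda>e. of_bool (P e))"
  by (simp add: decidable_in_def)

lemma decidable_in_subst:
  assumes "decidable_in g P" and "\<And>i. total_recursive g (F i)"
  shows "decidable_in g (\<lambda>e. P (\<lambda>i. F i e))"
  using total_recursive_subst[OF _ assms(2)] assms(1) unfolding decidable_in_def .

lemma decidable_in_const [recursive_intros]: "decidable_in g (\<lambda>e. b)"
  unfolding decidable_in_def by (rule total_recursive_const)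

lemma decidable_in_not [recursive_intros]:
  assumes "decidable_in g P"
  shows "decidable_in g (\<lambda>e. \<not> P e)"
proof -
  have "total_recursive g (\<lambda>e. 1 - of_bool (P e))"
    by (intro recursive_intros assms)
  moreover have "1 - of_bool p = (of_bool (\<not> p) :: nat)" for p by simp
  ultimately show ?thesis by (simp add: decidable_in_def)
qed

lemma decidable_in_conj [recursive_intros]:
  assumes "decidable_in g P" and "decidable_in g Q"
  shows "decidable_in g (\<lambda>e. P e \<and> Q e)"
proof -
  have "total_recursive g (\<lambda>e. of_bool (P e) * of_bool (Q e))"
    by (intro recursive_intros assms)
  then show ?thesis by (simp add: decidable_in_def of_bool_conj)
qed

lemma decidable_in_imp [recursive_intros]:
  assumes "decidable_in g P" and "decidable_in g Q"
  shows "decidable_in g (\<lambda>e. P e \<longrightarrow> Q e)"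
proof -
  have "decidable_in g (\<lambda>e. \<not> (P e \<and> \<not> Q e))"
    by (intro recursive_intros assms)
  then show ?thesis by simp
qed

lemma decidable_in_disj [recursive_intros]:
  assumes "decidable_in g P" and "decidable_in g Q"
  shows "decidable_in g (\<lambda>e. P e \<or> Q e)"
proof -
  have "decidable_in g (\<lambda>e. \<not> P e \<longrightarrow> Q e)"
    by (intro recursive_intros assms)
  then show ?thesis by (simp add: disj_imp)
qed

lemma decidable_in_iff [recursive_intros]:
  assumes "decidable_in g P" and "decidable_in g Q"
  shows "decidable_in g (\<lambda>e. P e \<longleftrightarrow> Q e)"
  unfolding iff_conv_conj_imp by (intro recursive_intros assms)

lemma decidable_in_le [recursive_intros]:
  assumes "total_recursive g A" and "total_recursive g B"
  shows "decidable_in g (\<lambda>e. A e \<le> B e)"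
proof -
  have "total_recursive g (\<lambda>e. 1 - (A e - B e))"
    by (intro recursive_intros assms)
  moreover have "1 - (a - b) = of_bool (a \<le> b)" for a b :: nat by auto
  ultimately show ?thesis by (simp add: decidable_in_def)
qed

lemma decidable_in_less [recursive_intros]:
  assumes "total_recursive g A" and "total_recursive g B"
  shows "decidable_in g (\<lambda>e. A e < B e)"
  unfolding Suc_le_eq[symmetric] by (intro recursive_intros assms)

lemma decidable_in_eq [recursive_intros]:
  fixes A B :: "(nat \<Rightarrow> nat) \<Rightarrow> nat"
  assumes "total_recursive g A" and "total_recursive g B"
  shows "decidable_in g (\<lambda>e. A e = B e)"
  unfolding eq_iff by (intro recursive_intros assms)

lemma total_recursive_if [recursive_intros]:
  assumes "decidable_in g P" and "total_recursive g A" and "total_recursive g B"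
  shows "total_recursive g (\<lambda>e. if P e then A e else B e)"
proof -
  have "total_recursive g (\<lambda>e. of_bool (P e) * A e + of_bool (\<not> P e) * B e)"
    by (intro recursive_intros assms)
  moreover have "of_bool p * a + of_bool (\<not> p) * b = (if p then a else b)" for p and a b :: nat
    by simp
  ultimately show ?thesis by simp
qed

lemma decidable_in_ball_list:
  assumes "\<And>q. q \<in> set qs \<Longrightarrow> decidable_in g (P q)"
  shows "decidable_in g (\<lambda>e. \<forall>q\<in>set qs. P q e)"
  using assms by (induction qs) (auto intro: recursive_intros)

section \<open>Bounded minimisation\<close>

definition bounded_least :: "nat \<Rightarrow> (nat \<Rightarrow> bool) \<Rightarrow> nat" where
  "bounded_least n P = (LEAST i. P i \<or> i = n)"

lemma bounded_least_satisfies: "P (bounded_least n P) \<or> bounded_least n P = n"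
  unfolding bounded_least_def by (rule LeastI[of _ n]) simp

lemma not_less_bounded_least: "i < bounded_least n P \<Longrightarrow> \<not> P i"
  unfolding bounded_least_def by (blast dest: not_less_Least)

lemma bounded_leastI_ex: "\<exists>i<n. P i \<Longrightarrow> P (bounded_least n P)"
  using bounded_least_satisfies[of P n] not_less_bounded_least[of _ n P] by auto

lemma bounded_least_le: "bounded_least n P \<le> n"
  unfolding bounded_least_def by (rule Least_le) simp

lemma bounded_least_equality:
  assumes "P i \<or> i = n" and "i \<le> n" and "\<And>j. j < i \<Longrightarrow> \<not> P j"
  shows "bounded_least n P = i"
  unfolding bounded_least_def using assms by (intro Least_equality) (auto simp: not_less[symmetric])

lemma bounded_least_eq_rec_nat:
  "bounded_least n P = rec_nat 0 (\<lambda>_ r. if P r then r else Suc r) n"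
proof (induction n)
  case 0
  show ?case by (simp add: bounded_least_def)
next
  case (Suc n)
  let ?r = "bounded_least n P"
  have "bounded_least (Suc n) P = (if P ?r then ?r else Suc ?r)"
  proof (cases "P ?r")
    case True
    then show ?thesis
      using bounded_least_le[of n P] not_less_bounded_least[of _ n P]
      by (simp add: bounded_least_equality)
  next
    case False
    then have r: "?r = n" using bounded_least_satisfies[of P n] by blast
    have "\<not> P j" if "j < Suc n" for j
      using that False r not_less_bounded_least[of j n P] by (auto simp: less_Suc_eq)
    then have "bounded_least (Suc n) P = Suc n" by (simp add: bounded_least_equality)
    then show ?thesis using False r by simp
  qed
  then show ?case by (simp add: Suc)
qed

lemma total_recursive_bounded_least [recursive_intros]:
  assumes N: "total_recursive g N" and P: "decidable_in g (\<lambda>e. P (e 0) (shift e))"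
  shows "total_recursive g (\<lambda>e. bounded_least (N e) (\<lambda>i. P i e))"
proof -
  have "decidable_in g (\<lambda>e. P (e 1) (shift (shift e)))"
    using decidable_in_subst[OF P, of "\<lambda>i e. e (Suc i)"] by (simp add: total_recursive_proj)
  then show ?thesis
    unfolding bounded_least_eq_rec_nat by (intro total_recursive_rec_nat N recursive_intros)
qed

lemma decidable_in_all_less [recursive_intros]:
  assumes "total_recursive g N" and "decidable_in g (\<lambda>e. P (e 0) (shift e))"
  shows "decidable_in g (\<lambda>e. \<forall>i<N e. P i e)"
proof -
  have "(\<forall>i<n. Q i) \<longleftrightarrow> bounded_least n (\<lambda>i. \<not> Q i) = n" for n Q
    using bounded_least_satisfies[of "\<lambda>i. \<not> Q i" n] bounded_least_le[of n "\<lambda>i. \<not> Q i"]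
      not_less_bounded_least[of _ n "\<lambda>i. \<not> Q i"] by (metis le_neq_implies_less)
  then show ?thesis by (simp only:) (intro recursive_intros assms)
qed

lemma decidable_in_ex_less [recursive_intros]:
  assumes "total_recursive g N" and "decidable_in g (\<lambda>e. P (e 0) (shift e))"
  shows "decidable_in g (\<lambda>e. \<exists>i<N e. P i e)"
proof -
  have "decidable_in g (\<lambda>e. \<not> (\<forall>i<N e. \<not> P i e))"
    by (intro recursive_intros assms)
  then show ?thesis by simp
qed

lemma total_recursive_div [recursive_intros]:
  assumes "total_recursive g A" and "total_recursive g B"
  shows "total_recursive g (\<lambda>e. A e div B e)"
proof (rule total_recursive_comp2[OF _ assms])
  have "bounded_least a (\<lambda>q. b = 0 \<or> a < Suc q * b) = a div b" for a b :: nat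
  proof (rule bounded_least_equality)
    show "(b = 0 \<or> a < Suc (a div b) * b) \<or> a div b = a"
      using dividend_less_div_times[of b a] by (auto simp: algebra_simps)
    show "\<not> (b = 0 \<or> a < Suc q * b)" if "q < a div b" for q
      using that less_eq_div_iff_mult_less_eq[of b "Suc q" a] by (cases "b = 0") (auto simp: not_less)
  qed simp
  moreover have "total_recursive g
      (\<lambda>e. bounded_least (e 0) (\<lambda>q. e 1 = 0 \<or> e 0 < Suc q * e 1))"
    by (intro recursive_intros)
  ultimately show "total_recursive g (\<lambda>e. e 0 div e 1)" by simp
qed

lemma decidable_in_set_decode [recursive_intros]:
  assumes "total_recursive g A" and "total_recursive g B"
  shows "decidable_in g (\<lambda>e. A e \<in> set_decode (B e))"
proof -
  have "odd n \<longleftrightarrow> n - 2 * (n div 2) = 1" for n :: nat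
    by (simp add: minus_mult_div_eq_mod odd_iff_mod_2_eq_one)
  then show ?thesis
    unfolding set_decode_def mem_Collect_eq by (simp only:) (intro recursive_intros assms)
qed

lemma total_recursive_prod_encode [recursive_intros]:
  assumes "total_recursive g A" and "total_recursive g B"
  shows "total_recursive g (\<lambda>e. prod_encode (A e, B e))"
  unfolding prod_encode_def triangle_def by (simp, intro recursive_intros assms)

section \<open>Evaluation with bounded use\<close>

text \<open>The value \<open>0\<close> stands for a missing result and \<open>Suc y\<close> for the result \<open>y\<close>. The bound
  \<open>t\<close> restricts only the minimisations and the oracle queries: for a fixed program this alone
  makes the evaluation total recursive, as primitive recursion needs no bound.\<close>

fun bounded_eval :: "(nat \<Rightarrow> nat) \<Rightarrow> nat \<Rightarrow> recfn \<Rightarrow> nat list \<Rightarrow> nat" where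
  "bounded_eval g t Zero xs = 1"
| "bounded_eval g t Succ xs = (case xs of [x] \<Rightarrow> Suc (Suc x) | _ \<Rightarrow> 0)"
| "bounded_eval g t Oracle xs = (case xs of [x] \<Rightarrow> if x < t then Suc (g x) else 0 | _ \<Rightarrow> 0)"
| "bounded_eval g t (Proj i) xs = (if i < length xs then Suc (xs ! i) else 0)"
| "bounded_eval g t (Comp p qs) xs =
     (if \<forall>q \<in> set qs. bounded_eval g t q xs \<noteq> 0
      then bounded_eval g t p (map (\<lambda>q. bounded_eval g t q xs - 1) qs) else 0)"
| "bounded_eval g t (PrimRec b s) xs =
     (case xs of
        [] \<Rightarrow> 0
      | n # ys \<Rightarrow>
          rec_nat (bounded_eval g t b ys)
            (\<lambda>m r. if r = 0 then 0 else bounded_eval g t s (m # (r - 1) # ys)) n)"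
| "bounded_eval g t (Minim p) xs =
     (let n = bounded_least t (\<lambda>n. bounded_eval g t p (n # xs) \<le> 1)
      in if n < t \<and> bounded_eval g t p (n # xs) = 1 then Suc n else 0)"

lemma bounded_eval_cong:
  assumes "\<And>i. i < t \<Longrightarrow> g i = h i"
  shows "bounded_eval g t p xs = bounded_eval h t p xs"
proof (induction p arbitrary: xs)
  case (Comp p qs)
  then show ?case by (auto cong: map_cong)
next
  case (Minim p)
  then show ?case by simp
qed (auto simp: assms split: list.split cong: if_cong)

lemma list_all2_eq_Some_iff:
  "list_all2 (\<lambda>x y. f x = Some y) xs ys \<longleftrightarrow>
     (\<forall>x\<in>set xs. f x \<noteq> None) \<and> ys = map (\<lambda>x. the (f x)) xs"
  by (induction xs arbitrary: ys) (auto simp: list_all2_Cons1)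

lemma list_all2_eq_Suc_iff:
  "list_all2 (\<lambda>x y. f x = Suc y) xs ys \<longleftrightarrow>
     (\<forall>x\<in>set xs. f x \<noteq> 0) \<and> ys = map (\<lambda>x. f x - 1) xs"
  by (induction xs arbitrary: ys) (auto simp: list_all2_Cons1 Suc_diff_Suc)

lemma run_Comp_eq_Some_iff:
  "run g (Comp p qs) xs = Some y \<longleftrightarrow>
     (\<exists>zs. list_all2 (\<lambda>q z. run g q xs = Some z) qs zs \<and> run g p zs = Some y)"
  by (simp add: list_all2_eq_Some_iff)

lemma bounded_eval_Comp_eq_Suc_iff:
  "bounded_eval g t (Comp p qs) xs = Suc y \<longleftrightarrow>
     (\<exists>zs. list_all2 (\<lambda>q z. bounded_eval g t q xs = Suc z) qs zs \<and> bounded_eval g t p zs = Suc y)"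
  by (simp add: list_all2_eq_Suc_iff)

lemma run_PrimRec_Suc_eq_Some_iff:
  "run g (PrimRec b s) (Suc n # xs) = Some y \<longleftrightarrow>
     (\<exists>v. run g (PrimRec b s) (n # xs) = Some v \<and> run g s (n # v # xs) = Some y)"
  by (auto split: option.splits)

lemma bounded_eval_PrimRec_Suc_eq_Suc_iff:
  "bounded_eval g t (PrimRec b s) (Suc n # xs) = Suc y \<longleftrightarrow>
     (\<exists>v. bounded_eval g t (PrimRec b s) (n # xs) = Suc v \<and>
        bounded_eval g t s (n # v # xs) = Suc y)"
  by (auto simp: gr0_conv_Suc split: if_splits)

lemma run_Minim_eq_Some_iff:
  "run g (Minim p) xs = Some n \<longleftrightarrow>
     run g p (n # xs) = Some 0 \<and> (\<forall>m<n. \<exists>v. run g p (m # xs) = Some (Suc v))"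
proof -
  have "(LEAST n. run g p (n # xs) = Some 0) = k"
    if "run g p (k # xs) = Some 0" and "\<forall>m<k. \<exists>v. run g p (m # xs) = Some (Suc v)" for k
    using that by (intro Least_equality) (auto simp: not_less[symmetric])
  then show ?thesis by auto
qed

lemma bounded_eval_Minim_eq_Suc_iff:
  "bounded_eval g t (Minim p) xs = Suc n \<longleftrightarrow>
     n < t \<and> bounded_eval g t p (n # xs) = Suc 0 \<and>
     (\<forall>m<n. \<exists>v. bounded_eval g t p (m # xs) = Suc (Suc v))"
proof -
  let ?v = "\<lambda>m. bounded_eval g t p (m # xs)"
  have "(\<exists>v. ?v m = Suc (Suc v)) \<longleftrightarrow> \<not> ?v m \<le> 1" for m
    by (auto simp: not_le Suc_less_eq2 gr0_conv_Suc)
  moreover have "bounded_eval g t (Minim p) xs = Suc n \<longleftrightarrow>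
      n < t \<and> ?v n = 1 \<and> (\<forall>m<n. \<not> ?v m \<le> 1)"
  proof
    assume "bounded_eval g t (Minim p) xs = Suc n"
    then show "n < t \<and> ?v n = 1 \<and> (\<forall>m<n. \<not> ?v m \<le> 1)"
      using not_less_bounded_least[of _ t "\<lambda>m. ?v m \<le> 1"] by (auto simp: Let_def split: if_splits)
  next
    assume n: "n < t \<and> ?v n = 1 \<and> (\<forall>m<n. \<not> ?v m \<le> 1)"
    then have "bounded_least t (\<lambda>m. ?v m \<le> 1) = n"
      by (intro bounded_least_equality) auto
    then show "bounded_eval g t (Minim p) xs = Suc n" using n by simp
  qed
  ultimately show ?thesis by simp
qed

lemma bounded_eval_sound:
  "bounded_eval g t p xs = Suc y \<Longrightarrow> run g p xs = Some y"
proof (induction p arbitrary: xs y)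
  case (Comp p qs)
  then obtain zs where zs: "list_all2 (\<lambda>q z. bounded_eval g t q xs = Suc z) qs zs"
      "bounded_eval g t p zs = Suc y"
    unfolding bounded_eval_Comp_eq_Suc_iff by blast
  have "list_all2 (\<lambda>q z. run g q xs = Some z) qs zs"
    using zs(1) by (rule list.rel_mono_strong) (rule Comp.IH(2))
  then show ?case using Comp.IH(1)[OF zs(2)] unfolding run_Comp_eq_Some_iff by blast
next
  case (PrimRec b s)
  obtain n ys where xs: "xs = n # ys" using PrimRec.prems by (cases xs) auto
  have "bounded_eval g t (PrimRec b s) (n # ys) = Suc y \<Longrightarrow> run g (PrimRec b s) (n # ys) = Some y"
  proof (induction n arbitrary: y)
    case (Suc n)
    then show ?case
      using PrimRec.IH(2)
      unfolding bounded_eval_PrimRec_Suc_eq_Suc_iff run_PrimRec_Suc_eq_Some_iff by blast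
  qed (simp add: PrimRec.IH)
  then show ?case using xs PrimRec.prems by simp
next
  case (Minim p)
  then show ?case unfolding bounded_eval_Minim_eq_Suc_iff run_Minim_eq_Some_iff by blast
qed (auto split: list.splits if_splits)

lemma bounded_eval_complete:
  "run g p xs = Some y \<Longrightarrow> \<forall>\<^sub>F t in sequentially. bounded_eval g t p xs = Suc y"
proof (induction p arbitrary: xs y)
  case Oracle
  then obtain x where "xs = [x]" "y = g x" by (auto split: list.splits)
  then show ?case by (intro eventually_sequentiallyI[of "Suc x"]) simp
next
  case (Comp p qs)
  then obtain zs where zs: "list_all2 (\<lambda>q z. run g q xs = Some z) qs zs" "run g p zs = Some y"
    unfolding run_Comp_eq_Some_iff by blast
  then have "\<forall>\<^sub>F t in sequentially. \<forall>i\<in>{..<length qs}. bounded_eval g t (qs ! i) xs = Suc (zs ! i)"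
    using Comp.IH(2) by (intro eventually_ball_finite) (auto simp: list_all2_conv_all_nth)
  then have "\<forall>\<^sub>F t in sequentially. list_all2 (\<lambda>q z. bounded_eval g t q xs = Suc z) qs zs"
    by eventually_elim (use zs(1) in \<open>auto simp: list_all2_conv_all_nth\<close>)
  with Comp.IH(1)[OF zs(2)] show ?case
    unfolding bounded_eval_Comp_eq_Suc_iff by eventually_elim blast
next
  case (PrimRec b s)
  obtain n ys where xs: "xs = n # ys" using PrimRec.prems by (cases xs) auto
  have "run g (PrimRec b s) (n # ys) = Some y \<Longrightarrow>
      \<forall>\<^sub>F t in sequentially. bounded_eval g t (PrimRec b s) (n # ys) = Suc y"
  proof (induction n arbitrary: y)
    case (Suc n)
    then obtain v where v: "run g (PrimRec b s) (n # ys) = Some v" "run g s (n # v # ys) = Some y"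
      unfolding run_PrimRec_Suc_eq_Some_iff by blast
    show ?case
      using Suc.IH[OF v(1)] PrimRec.IH(2)[OF v(2)]
      unfolding bounded_eval_PrimRec_Suc_eq_Suc_iff by eventually_elim blast
  qed (simp add: PrimRec.IH)
  then show ?case using xs PrimRec.prems by simp
next
  case (Minim p)
  then have n: "run g p (y # xs) = Some 0" "\<forall>m<y. \<exists>v. run g p (m # xs) = Some (Suc v)"
    unfolding run_Minim_eq_Some_iff by blast+
  then obtain v where "\<forall>m<y. run g p (m # xs) = Some (Suc (v m))" by metis
  then have "\<forall>\<^sub>F t in sequentially. \<forall>m\<in>{..<y}. bounded_eval g t p (m # xs) = Suc (Suc (v m))"
    using Minim.IH by (intro eventually_ball_finite) auto
  with Minim.IH[OF n(1)] eventually_gt_at_top[of y] show ?case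
    unfolding bounded_eval_Minim_eq_Suc_iff by eventually_elim simp
qed (auto split: list.splits if_splits)

lemma run_eq_Some_iff_bounded_eval:
  "run g p xs = Some y \<longleftrightarrow> (\<exists>t. bounded_eval g t p xs = Suc y)"
  using bounded_eval_sound eventually_happens'[OF sequentially_bot bounded_eval_complete] by blast

text \<open>The oracle \<open>h c\<close> is selected by a code \<open>c\<close> that may itself vary. Quantifying over the
  arguments lets the induction on programs evaluate subprograms under additional variables.\<close>

definition recursively_evaluable :: "(nat \<Rightarrow> nat) \<Rightarrow> (nat \<Rightarrow> nat \<Rightarrow> nat) \<Rightarrow> recfn \<Rightarrow> bool" where
  "recursively_evaluable g h p \<longleftrightarrow>
     (\<forall>C T As. total_recursive g C \<longrightarrow> total_recursive g T \<longrightarrow> (\<forall>A\<in>set As. total_recursive g A) \<longrightarrow>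
        total_recursive g (\<lambda>e. bounded_eval (h (C e)) (T e) p (map (\<lambda>A. A e) As)))"

lemma recursively_evaluableI:
  assumes "\<And>C T As. total_recursive g C \<Longrightarrow> total_recursive g T \<Longrightarrow>
      (\<And>A. A \<in> set As \<Longrightarrow> total_recursive g A) \<Longrightarrow>
      total_recursive g (\<lambda>e. bounded_eval (h (C e)) (T e) p (map (\<lambda>A. A e) As))"
  shows "recursively_evaluable g h p"
  using assms unfolding recursively_evaluable_def by simp

lemma recursively_evaluableD:
  assumes "recursively_evaluable g h p" and "total_recursive g C" and "total_recursive g T"
    and "\<And>A. A \<in> set As \<Longrightarrow> total_recursive g A"
  shows "total_recursive g (\<lambda>e. bounded_eval (h (C e)) (T e) p (map (\<lambda>A. A e) As))"
  using assms unfolding recursively_evaluable_def by simp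

lemma recursively_evaluable_Comp:
  assumes p: "recursively_evaluable g h p"
    and qs: "\<And>q. q \<in> set qs \<Longrightarrow> recursively_evaluable g h q"
  shows "recursively_evaluable g h (Comp p qs)"
proof (rule recursively_evaluableI)
  fix C T As
  assume C: "total_recursive g C" and T: "total_recursive g T"
    and As: "\<And>A. A \<in> set As \<Longrightarrow> total_recursive g A"
  let ?q = "\<lambda>q e. bounded_eval (h (C e)) (T e) q (map (\<lambda>A. A e) As)"
  have q: "total_recursive g (?q q)" if "q \<in> set qs" for q
    using qs[OF that] C T As by (rule recursively_evaluableD)
  have "total_recursive g (\<lambda>e. bounded_eval (h (C e)) (T e) p
      (map (\<lambda>A. A e) (map (\<lambda>q e. ?q q e - 1) qs)))"
    using q by (intro recursively_evaluableD[OF p C T]) (auto intro!: recursive_intros)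
  then have "total_recursive g (\<lambda>e. if \<forall>q\<in>set qs. ?q q e \<noteq> 0
      then bounded_eval (h (C e)) (T e) p (map (\<lambda>q. ?q q e - 1) qs) else 0)"
    unfolding map_map comp_def by (intro decidable_in_ball_list recursive_intros q)
  then show "total_recursive g (?q (Comp p qs))" by simp
qed

lemma recursively_evaluable_PrimRec:
  assumes b: "recursively_evaluable g h b" and s: "recursively_evaluable g h s"
  shows "recursively_evaluable g h (PrimRec b s)"
proof (rule recursively_evaluableI)
  fix C T As
  assume C: "total_recursive g C" and T: "total_recursive g T"
    and As: "\<And>A. A \<in> set As \<Longrightarrow> total_recursive g A"
  show "total_recursive g (\<lambda>e. bounded_eval (h (C e)) (T e) (PrimRec b s) (map (\<lambda>A. A e) As))"
  proof (cases As)
    case Nil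
    then show ?thesis by (simp add: total_recursive_const)
  next
    case (Cons N Bs)
    let ?s = "\<lambda>m r e. bounded_eval (h (C e)) (T e) s (m # (r - 1) # map (\<lambda>A. A e) Bs)"
    have "total_recursive g (\<lambda>e. bounded_eval (h (C (shift (shift e)))) (T (shift (shift e))) s
        (map (\<lambda>A. A e) ((\<lambda>e. e 0) # (\<lambda>e. e 1 - 1) # map (\<lambda>B e. B (shift (shift e))) Bs)))"
      using As Cons
      by (intro recursively_evaluableD[OF s] total_recursive_shift C T)
        (auto intro!: recursive_intros total_recursive_shift)
    then have "total_recursive g (\<lambda>e. ?s (e 0) (e 1) (shift (shift e)))"
      by (simp add: comp_def)
    then have "total_recursive g (\<lambda>e. rec_nat (bounded_eval (h (C e)) (T e) b (map (\<lambda>A. A e) Bs))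
        (\<lambda>m r. if r = 0 then 0 else ?s m r e) (N e))"
      using As Cons
      by (intro total_recursive_rec_nat recursively_evaluableD[OF b C T] recursive_intros) auto
    then show ?thesis by (simp add: Cons)
  qed
qed

lemma recursively_evaluable_Minim:
  assumes p: "recursively_evaluable g h p"
  shows "recursively_evaluable g h (Minim p)"
proof (rule recursively_evaluableI)
  fix C T As
  assume C: "total_recursive g C" and T: "total_recursive g T"
    and As: "\<And>A. A \<in> set As \<Longrightarrow> total_recursive g A"
  let ?p = "\<lambda>n e. bounded_eval (h (C e)) (T e) p (n # map (\<lambda>A. A e) As)"
  let ?n = "\<lambda>e. bounded_least (T e) (\<lambda>n. ?p n e \<le> 1)"
  have "total_recursive g (\<lambda>e. bounded_eval (h (C (shift e))) (T (shift e)) p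
      (map (\<lambda>A. A e) ((\<lambda>e. e 0) # map (\<lambda>A e. A (shift e)) As)))"
    using As by (intro recursively_evaluableD[OF p] total_recursive_shift C T)
      (auto intro!: recursive_intros total_recursive_shift)
  then have "total_recursive g (\<lambda>e. ?p (e 0) (shift e))"
    by (simp add: comp_def)
  then have n: "total_recursive g ?n"
    by (intro recursive_intros T)
  have "total_recursive g (\<lambda>e. bounded_eval (h (C e)) (T e) p (map (\<lambda>A. A e) (?n # As)))"
    using n As by (intro recursively_evaluableD[OF p C T]) auto
  then have "total_recursive g (\<lambda>e. if ?n e < T e \<and> ?p (?n e) e = 1 then Suc (?n e) else 0)"
    by (intro recursive_intros n T) simp
  then show "total_recursive g (\<lambda>e. bounded_eval (h (C e)) (T e) (Minim p) (map (\<lambda>A. A e) As))"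
    by (simp only: bounded_eval.simps Let_def)
qed

lemma all_recursively_evaluable:
  assumes h: "total_recursive g (\<lambda>e. h (e 0) (e 1))"
  shows "recursively_evaluable g h p"
proof (induction p)
  case Zero
  show ?case by (rule recursively_evaluableI) (simp add: total_recursive_const)
next
  case Succ
  show ?case
  proof (rule recursively_evaluableI)
    show "total_recursive g (\<lambda>e. bounded_eval (h (C e)) (T e) Succ (map (\<lambda>A. A e) As))"
      if "\<And>A. A \<in> set As \<Longrightarrow> total_recursive g A" for C T As
      using that by (cases As rule: remdups_adj.cases) (auto intro!: recursive_intros)
  qed
next
  case Oracle
  show ?case
  proof (rule recursively_evaluableI)
    show "total_recursive g (\<lambda>e. bounded_eval (h (C e)) (T e) Oracle (map (\<lambda>A. A e) As))"
      if "total_recursive g C" "total_recursive g T" "\<And>A. A \<in> set As \<Longrightarrow> total_recursive g A"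
      for C T As
      using that by (cases As rule: remdups_adj.cases)
        (auto intro!: recursive_intros total_recursive_comp2[OF h])
  qed
next
  case (Proj i)
  show ?case
  proof (rule recursively_evaluableI)
    show "total_recursive g (\<lambda>e. bounded_eval (h (C e)) (T e) (Proj i) (map (\<lambda>A. A e) As))"
      if "\<And>A. A \<in> set As \<Longrightarrow> total_recursive g A" for C T As
      using that by (cases "i < length As") (auto intro!: recursive_intros)
  qed
qed (auto intro: recursively_evaluable_Comp recursively_evaluable_PrimRec
    recursively_evaluable_Minim)

lemma total_recursive_bounded_eval:
  assumes "total_recursive g (\<lambda>e. h (e 0) (e 1))"
    and "total_recursive g C" and "total_recursive g T" and "total_recursive g A"
  shows "total_recursive g (\<lambda>e. bounded_eval (h (C e)) (T e) p [A e])"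
  using recursively_evaluableD[OF all_recursively_evaluable[OF assms(1)] assms(2,3), of "[A]"] assms(4)
  by simp

section \<open>Semidecidable predicates\<close>

definition semidecidable_in :: "(nat \<Rightarrow> nat) \<Rightarrow> ((nat \<Rightarrow> nat) \<Rightarrow> bool) \<Rightarrow> bool" where
  "semidecidable_in g P \<longleftrightarrow>
     (\<exists>Q. decidable_in g (\<lambda>e. Q (e 0) (shift e)) \<and> (\<forall>e. P e \<longleftrightarrow> (\<exists>t. Q t e)))"

lemma case_nat_apply: "(\<lambda>i. case_nat a F i e) = case_nat (a e) (\<lambda>i. F i e)"
  by (auto split: nat.split)

lemma decidable_in_subst_Suc:
  assumes "decidable_in g (\<lambda>e. Q (e 0) (shift e))"
    and "total_recursive g A" and "\<And>i. total_recursive g (F i)"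
  shows "decidable_in g (\<lambda>e. Q (A e) (\<lambda>i. F i e))"
  using decidable_in_subst[OF assms(1), of "case_nat A F"] assms(2,3)
  by (simp split: nat.split)

lemma decidable_in_subst_Suc_Suc:
  assumes "decidable_in g (\<lambda>e. Q (e 0) (shift e))"
    and "total_recursive g A" and "total_recursive g B" and "\<And>i. total_recursive g (F i)"
  shows "decidable_in g (\<lambda>e. Q (A e) (case_nat (B e) (\<lambda>i. F i e)))"
  using decidable_in_subst_Suc[OF assms(1,2), of "case_nat B F"] assms(3,4)
  by (simp add: case_nat_apply split: nat.split)

lemma semidecidable_in_monotone_stages:
  assumes "semidecidable_in g P"
  obtains Q where "decidable_in g (\<lambda>e. Q (e 0) (shift e))" and "\<And>e. P e \<longleftrightarrow> (\<exists>t. Q t e)"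
    and "\<And>s t e. Q s e \<Longrightarrow> s \<le> t \<Longrightarrow> Q t e"
proof -
  obtain Q where Q: "decidable_in g (\<lambda>e. Q (e 0) (shift e))" and P: "\<forall>e. P e \<longleftrightarrow> (\<exists>t. Q t e)"
    using assms unfolding semidecidable_in_def by blast
  show thesis
  proof (rule that[of "\<lambda>t e. \<exists>s<Suc t. Q s e"])
    show "decidable_in g (\<lambda>e. \<exists>s<Suc (e 0). Q s (shift e))"
      by (intro recursive_intros decidable_in_subst_Suc[OF Q])
  qed (use P in \<open>auto intro: less_le_trans\<close>)
qed

lemma semidecidable_in_if_decidable:
  assumes "decidable_in g P"
  shows "semidecidable_in g P"
  unfolding semidecidable_in_def
  using decidable_in_subst[OF assms, of "\<lambda>i e. e (Suc i)"]
  by (intro exI[of _ "\<lambda>_. P"]) (simp add: total_recursive_proj)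

lemma semidecidable_in_subst:
  assumes "semidecidable_in g P" and F: "\<And>i. total_recursive g (F i)"
  shows "semidecidable_in g (\<lambda>e. P (\<lambda>i. F i e))"
proof -
  obtain Q where Q: "decidable_in g (\<lambda>e. Q (e 0) (shift e))" and P: "\<forall>e. P e \<longleftrightarrow> (\<exists>t. Q t e)"
    using assms(1) unfolding semidecidable_in_def by blast
  have "decidable_in g (\<lambda>e. Q (e 0) (\<lambda>i. F i (shift e)))"
    by (intro decidable_in_subst_Suc[OF Q] total_recursive_shift recursive_intros F)
  then show ?thesis
    unfolding semidecidable_in_def using P by (intro exI[of _ "\<lambda>t e. Q t (\<lambda>i. F i e)"]) simp
qed

lemma semidecidable_in_conj:
  assumes "semidecidable_in g P" and "semidecidable_in g P'"
  shows "semidecidable_in g (\<lambda>e. P e \<and> P' e)"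
proof -
  obtain Q where Q: "decidable_in g (\<lambda>e. Q (e 0) (shift e))"
    and P: "\<And>e. P e \<longleftrightarrow> (\<exists>t. Q t e)"
    and mono: "\<And>s t e. Q s e \<Longrightarrow> s \<le> t \<Longrightarrow> Q t e"
    using semidecidable_in_monotone_stages[OF assms(1)] by blast
  obtain Q' where Q': "decidable_in g (\<lambda>e. Q' (e 0) (shift e))"
    and P': "\<And>e. P' e \<longleftrightarrow> (\<exists>t. Q' t e)"
    and mono': "\<And>s t e. Q' s e \<Longrightarrow> s \<le> t \<Longrightarrow> Q' t e"
    using semidecidable_in_monotone_stages[OF assms(2)] by blast
  have "P e \<and> P' e \<longleftrightarrow> (\<exists>t. Q t e \<and> Q' t e)" for e
    unfolding P P' by (meson mono mono' linear)
  then show ?thesis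
    unfolding semidecidable_in_def
    by (intro exI[of _ "\<lambda>t e. Q t e \<and> Q' t e"] conjI recursive_intros Q Q') simp
qed

lemma semidecidable_in_imp:
  assumes P: "decidable_in g P" and "semidecidable_in g P'"
  shows "semidecidable_in g (\<lambda>e. P e \<longrightarrow> P' e)"
proof -
  obtain Q where Q: "decidable_in g (\<lambda>e. Q (e 0) (shift e))"
    and P': "\<forall>e. P' e \<longleftrightarrow> (\<exists>t. Q t e)"
    using assms(2) unfolding semidecidable_in_def by blast
  have "decidable_in g (\<lambda>e. P (shift e) \<longrightarrow> Q (e 0) (shift e))"
    by (intro recursive_intros Q decidable_in_subst[OF P])
  then show ?thesis
    unfolding semidecidable_in_def using P' by (intro exI[of _ "\<lambda>t e. P e \<longrightarrow> Q t e"]) simp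
qed

lemma semidecidable_in_ex:
  assumes "semidecidable_in g (\<lambda>e. P (e 0) (shift e))"
  shows "semidecidable_in g (\<lambda>e. \<exists>i. P i e)"
proof -
  obtain Q where Q: "decidable_in g (\<lambda>e. Q (e 0) (shift e))"
    and P: "\<And>e. P (e 0) (shift e) \<longleftrightarrow> (\<exists>t. Q t e)"
    and mono: "\<And>s t e. Q s e \<Longrightarrow> s \<le> t \<Longrightarrow> Q t e"
    using semidecidable_in_monotone_stages[OF assms] by blast
  have "(\<exists>i. P i e) \<longleftrightarrow> (\<exists>t. \<exists>i<t. Q t (case_nat i e))" for e
  proof
    assume "\<exists>i. P i e"
    then obtain i t where "Q t (case_nat i e)" using P[of "case_nat _ e"] by auto
    then have "Q (max t (Suc i)) (case_nat i e)" by (rule mono) simp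
    then show "\<exists>t. \<exists>i<t. Q t (case_nat i e)" by (meson lessI less_max_iff_disj)
  qed (use P[of "case_nat _ e"] in auto)
  moreover have "decidable_in g (\<lambda>e. \<exists>i<e 0. Q (e 0) (case_nat i (shift e)))"
    by (intro recursive_intros decidable_in_subst_Suc_Suc[OF Q])
  ultimately show ?thesis
    unfolding semidecidable_in_def
    by (intro exI[of _ "\<lambda>t e. \<exists>i<t. Q t (case_nat i e)"]) simp
qed

lemma semidecidable_in_all_less:
  assumes N: "total_recursive g N" and "semidecidable_in g (\<lambda>e. P (e 0) (shift e))"
  shows "semidecidable_in g (\<lambda>e. \<forall>i<N e. P i e)"
proof -
  obtain Q where Q: "decidable_in g (\<lambda>e. Q (e 0) (shift e))"
    and P: "\<And>e. P (e 0) (shift e) \<longleftrightarrow> (\<exists>t. Q t e)"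
    and mono: "\<And>s t e. Q s e \<Longrightarrow> s \<le> t \<Longrightarrow> Q t e"
    using semidecidable_in_monotone_stages[OF assms(2)] by blast
  have P_iff: "P i e \<longleftrightarrow> (\<forall>\<^sub>F t in sequentially. Q t (case_nat i e))" for i e
    using P[of "case_nat i e"] mono unfolding eventually_sequentially by auto
  have "(\<forall>i<n. P i e) \<longleftrightarrow> (\<exists>t. \<forall>i<n. Q t (case_nat i e))" for n e
  proof
    assume "\<forall>i<n. P i e"
    then have "\<forall>\<^sub>F t in sequentially. \<forall>i\<in>{..<n}. Q t (case_nat i e)"
      by (intro eventually_ball_finite) (simp_all add: P_iff)
    from eventually_happens'[OF sequentially_bot this]
    show "\<exists>t. \<forall>i<n. Q t (case_nat i e)" by auto
  qed (use P[of "case_nat _ e"] in auto)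
  moreover have "decidable_in g (\<lambda>e. \<forall>i<N (shift e). Q (e 0) (case_nat i (shift e)))"
    by (intro recursive_intros total_recursive_shift N decidable_in_subst_Suc_Suc[OF Q])
  ultimately show ?thesis
    unfolding semidecidable_in_def
    by (intro exI[of _ "\<lambda>t e. \<forall>i<N e. Q t (case_nat i e)"]) simp
qed

lemma semidecidable_in_run:
  assumes h: "total_recursive g (\<lambda>e. h (e 0))"
    and A: "total_recursive g A" and B: "total_recursive g B"
  shows "semidecidable_in g (\<lambda>e. run h p [A e] = Some (B e))"
proof -
  have "total_recursive g (\<lambda>e. h (e 1))"
    by (rule total_recursive_comp1[OF h]) (rule total_recursive_proj)
  then have "decidable_in g (\<lambda>e. bounded_eval h (e 0) p [A (shift e)] = Suc (B (shift e)))"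
    by (intro recursive_intros total_recursive_bounded_eval[where h = "\<lambda>_. h"]
        total_recursive_shift A B)
  then show ?thesis
    unfolding semidecidable_in_def run_eq_Some_iff_bounded_eval
    by (intro exI[of _ "\<lambda>t e. bounded_eval h t p [A e] = Suc (B e)"]) simp
qed

section \<open>Unbounded search\<close>

lemma total_recursive_program:
  assumes "total_recursive g F"
  obtains p where "\<And>xs. length xs = k \<Longrightarrow> run g p xs = Some (F (nth_default 0 xs))"
proof -
  obtain p where "\<forall>\<^sub>F n in sequentially. \<forall>e. run g p (map e [0..<n]) = Some (F e)"
    using assms unfolding total_recursive_def by blast
  from eventually_happens'[OF sequentially_bot this]
  obtain n where p: "\<forall>e. run g p (map e [0..<n]) = Some (F e)" ..
  define qs where "qs = map (\<lambda>i. if i < k then Proj i else Zero) [0..<n]"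
  have "run g (Comp p qs) xs = Some (F (nth_default 0 xs))" if "length xs = k" for xs
  proof -
    have "\<forall>q\<in>set qs. run g q xs \<noteq> None"
      using that by (auto simp: qs_def)
    moreover have "map (\<lambda>q. the (run g q xs)) qs = map (nth_default 0 xs) [0..<n]"
      using that by (auto simp: qs_def nth_default_def)
    ultimately show ?thesis using p by simp
  qed
  then show thesis by (rule that)
qed

lemma partial_computable_in_search:
  assumes P: "decidable_in g (\<lambda>e. P (e 0) (e 1))" and V: "total_recursive g (\<lambda>e. V (e 0) (e 1))"
  shows "partial_computable_in g
    (\<lambda>n. if \<exists>w. P w n then Some (V (LEAST w. P w n) n) else None)"
proof -
  have "total_recursive g (\<lambda>e. of_bool (\<not> P (e 0) (e 1)))"
    by (intro recursive_intros P)
  then obtain q where "\<And>xs. length xs = 2 \<Longrightarrow>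
      run g q xs = Some (of_bool (\<not> P (nth_default 0 xs 0) (nth_default 0 xs 1)))"
    by (rule total_recursive_program[where k = 2]) blast
  then have q: "run g q [w, n] = Some (of_bool (\<not> P w n))" for w n by simp
  obtain v where "\<And>xs. length xs = 2 \<Longrightarrow>
      run g v xs = Some (V (nth_default 0 xs 0) (nth_default 0 xs 1))"
    using V by (rule total_recursive_program[where k = 2]) blast
  then have v: "run g v [w, n] = Some (V w n)" for w n by simp
  have run_Minim: "run g (Minim q) [n] = Some w \<longleftrightarrow> P w n \<and> (\<forall>m<w. \<not> P m n)" for n w
    unfolding run_Minim_eq_Some_iff q by auto
  have "run g (Minim q) [n] = (if \<exists>w. P w n then Some (LEAST w. P w n) else None)" for n
  proof (cases "\<exists>w. P w n")
    case True
    then have "run g (Minim q) [n] = Some (LEAST w. P w n)"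
      unfolding run_Minim by (auto intro: LeastI_ex[of "\<lambda>w. P w n"] dest: not_less_Least)
    with True show ?thesis by simp
  next
    case False
    then show ?thesis using run_Minim by (metis option.exhaust)
  qed
  then have "run g (Comp v [Minim q, Proj 0]) [n] =
      (if \<exists>w. P w n then Some (V (LEAST w. P w n) n) else None)" for n
    by (simp add: v del: run.simps(7))
  then show ?thesis unfolding partial_computable_in_def by metis
qed

lemma semidecidable_in_binary_stages:
  assumes "semidecidable_in g (\<lambda>e. R (e 0) (e 1))"
  obtains C where "\<And>T N Y. total_recursive g T \<Longrightarrow> total_recursive g N \<Longrightarrow> total_recursive g Y \<Longrightarrow>
      decidable_in g (\<lambda>e. C (T e) (N e) (Y e))"
    and "\<And>n y. R n y \<longleftrightarrow> (\<exists>t. C t n y)" and "\<And>s t n y. C s n y \<Longrightarrow> s \<le> t \<Longrightarrow> C t n y"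
proof -
  obtain Q where Q: "decidable_in g (\<lambda>e. Q (e 0) (shift e))"
    and R: "\<And>e. R (e 0) (e 1) \<longleftrightarrow> (\<exists>t. Q t e)"
    and mono: "\<And>s t e. Q s e \<Longrightarrow> s \<le> t \<Longrightarrow> Q t e"
    using semidecidable_in_monotone_stages[OF assms] by blast
  show thesis
  proof (rule that[of "\<lambda>t n y. Q t (case_nat n (case_nat y (\<lambda>_. 0)))"])
    show "decidable_in g (\<lambda>e. Q (T e) (case_nat (N e) (case_nat (Y e) (\<lambda>_. 0))))"
      if "total_recursive g T" "total_recursive g N" "total_recursive g Y" for T N Y
      unfolding case_nat_apply[of Y "\<lambda>_ _. 0", symmetric]
      by (intro decidable_in_subst_Suc_Suc[OF Q] that)
        (simp add: that(3) total_recursive_const split: nat.split)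
    show "R n y \<longleftrightarrow> (\<exists>t. Q t (case_nat n (case_nat y (\<lambda>_. 0))))" for n y
      using R[of "case_nat n (case_nat y (\<lambda>_. 0))"] by simp
  qed (rule mono)
qed

text \<open>A search stage \<open>w\<close> bounds both the value \<open>y\<close> and the stage at which \<open>R n y\<close> is
  confirmed, so no pairing is needed.\<close>

lemma semidecidable_in_selection:
  assumes "semidecidable_in g (\<lambda>e. R (e 0) (e 1))"
  obtains d where "partial_computable_in g d" and "\<And>n y. d n = Some y \<Longrightarrow> R n y"
    and "dom d = {n. \<exists>y. R n y}"
proof -
  obtain C where C: "\<And>T N Y. total_recursive g T \<Longrightarrow> total_recursive g N \<Longrightarrow> total_recursive g Y \<Longrightarrow>
      decidable_in g (\<lambda>e. C (T e) (N e) (Y e))"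
    and R: "\<And>n y. R n y \<longleftrightarrow> (\<exists>t. C t n y)" and mono: "\<And>s t n y. C s n y \<Longrightarrow> s \<le> t \<Longrightarrow> C t n y"
    using semidecidable_in_binary_stages[OF assms] by blast
  define P where "P w n \<longleftrightarrow> (\<exists>y<w. C w n y)" for w n
  define V where "V w n = bounded_least w (C w n)" for w n
  define d where "d n = (if \<exists>w. P w n then Some (V (LEAST w. P w n) n) else None)" for n
  have "partial_computable_in g d"
    unfolding d_def
  proof (rule partial_computable_in_search)
    show "decidable_in g (\<lambda>e. P (e 0) (e 1))"
      unfolding P_def by (intro recursive_intros C)
    show "total_recursive g (\<lambda>e. V (e 0) (e 1))"
      unfolding V_def by (intro recursive_intros C)
  qed
  moreover have "R n y" if "d n = Some y" for n y
  proof -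
    define w where "w = (LEAST w. P w n)"
    have "P w n" and "y = V w n"
      using that LeastI_ex[of "\<lambda>w. P w n"] by (auto simp: d_def w_def split: if_splits)
    then have "C w n y"
      unfolding P_def V_def using bounded_leastI_ex[of w "C w n"] by simp
    then show ?thesis using R by blast
  qed
  moreover have "(\<exists>w. P w n) \<longleftrightarrow> (\<exists>y. R n y)" for n
  proof
    assume "\<exists>y. R n y"
    then obtain t y where "C t n y" using R by blast
    then have "C (max t (Suc y)) n y" by (rule mono) simp
    then show "\<exists>w. P w n" unfolding P_def by (meson lessI less_max_iff_disj)
  qed (use R P_def in blast)
  then have "dom d = {n. \<exists>y. R n y}" by (auto simp: d_def dom_def)
  ultimately show thesis by (rule that)
qed

section \<open>Computably enumerable sets\<close>

lemma in_set_decode_less: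
  assumes "j \<in> set_decode c"
  shows "j < c"
proof -
  have "2 ^ j \<le> c"
    using assms unfolding set_decode_def by (metis div_less even_zero leI mem_Collect_eq)
  then show ?thesis using less_exp[of j] by linarith
qed

lemma semidecidable_in_dom_run:
  assumes "total_recursive g (\<lambda>e. h (e 0))"
  shows "semidecidable_in g (\<lambda>e. e 0 \<in> dom (\<lambda>n. run h p [n]))"
proof -
  have "semidecidable_in g (\<lambda>e. \<exists>y. run h p [e 0] = Some y)"
    by (intro semidecidable_in_ex semidecidable_in_run assms recursive_intros)
  then show ?thesis by (simp add: dom_def)
qed

lemma ce_in_iff_dom_run: "ce_in g S \<longleftrightarrow> (\<exists>p. S = dom (\<lambda>n. run g p [n]))"
proof -
  have "partial_computable_in g d \<longleftrightarrow> (\<exists>p. d = (\<lambda>n. run g p [n]))" for d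
    unfolding partial_computable_in_def fun_eq_iff ..
  then show ?thesis by (auto simp: ce_in_def)
qed

instance recfn :: countable
  by countable_datatype

lemma countable_ce_in: "countable {S. ce_in g S}"
proof -
  have "{S. ce_in g S} = range (\<lambda>p. dom (\<lambda>n. run g p [n]))"
    by (auto simp: ce_in_iff_dom_run)
  then show ?thesis by simp
qed

lemma ce_in_iff_semidecidable_in: "ce_in g S \<longleftrightarrow> semidecidable_in g (\<lambda>e. e 0 \<in> S)"
proof
  assume "ce_in g S"
  moreover have "total_recursive g (\<lambda>e. g (e 0))"
    by (intro total_recursive_oracle recursive_intros)
  ultimately show "semidecidable_in g (\<lambda>e. e 0 \<in> S)"
    using semidecidable_in_dom_run[of g g] unfolding ce_in_iff_dom_run by auto
next
  assume "semidecidable_in g (\<lambda>e. e 0 \<in> S)"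
  then obtain d where "partial_computable_in g d" "dom d = {n. \<exists>y::nat. n \<in> S}"
    by (rule semidecidable_in_selection[where R = "\<lambda>n _. n \<in> S"])
  then show "ce_in g S" unfolding ce_in_def by auto
qed

lemma ce_in_trans:
  assumes "total_recursive g (\<lambda>e. h (e 0))" and "ce_in h S"
  shows "ce_in g S"
proof -
  obtain p where "S = dom (\<lambda>n. run h p [n])"
    using assms(2) unfolding ce_in_iff_dom_run by blast
  then show ?thesis
    unfolding ce_in_iff_semidecidable_in using semidecidable_in_dom_run[OF assms(1)] by simp
qed

lemma ce_in_if_ce: "ce S \<Longrightarrow> ce_in g S"
  by (rule ce_in_trans[where h = "\<lambda>_. 0", OF total_recursive_const])
    (simp add: ce_def ce_in_def partial_computable_def)

lemma semidecidable_in_mem: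
  assumes "ce_in g S" and "total_recursive g A"
  shows "semidecidable_in g (\<lambda>e. A e \<in> S)"
  using semidecidable_in_subst[of g "\<lambda>e. e 0 \<in> S" "\<lambda>_. A"] assms
  unfolding ce_in_iff_semidecidable_in by simp

lemma prod_encode_in_gra_iff: "prod_encode (n, y) \<in> gra d \<longleftrightarrow> d n = Some y"
  by (auto simp: gra_def prod_encode_eq)

lemma ce_in_gra_iff: "ce_in g (gra d) \<longleftrightarrow> partial_computable_in g d"
proof
  assume "partial_computable_in g d"
  then obtain p where p: "\<forall>n. d n = run g p [n]" unfolding partial_computable_in_def ..
  have "semidecidable_in g (\<lambda>e. \<exists>n y. e 0 = prod_encode (n, y) \<and> run g p [n] = Some y)"
    by (intro semidecidable_in_ex semidecidable_in_conj semidecidable_in_if_decidable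
        semidecidable_in_run total_recursive_oracle recursive_intros)
  then show "ce_in g (gra d)"
    by (simp add: ce_in_iff_semidecidable_in gra_def p)
next
  assume "ce_in g (gra d)"
  then have "semidecidable_in g (\<lambda>e. prod_encode (e 0, e 1) \<in> gra d)"
    by (rule semidecidable_in_mem) (intro recursive_intros)
  then have "semidecidable_in g (\<lambda>e. d (e 0) = Some (e 1))"
    unfolding prod_encode_in_gra_iff .
  then obtain d' where d': "partial_computable_in g d'" "\<And>n y. d' n = Some y \<Longrightarrow> d n = Some y"
      "dom d' = {n. \<exists>y. d n = Some y}"
    by (rule semidecidable_in_selection) blast
  have "dom d' = dom d" using d'(3) by (simp add: dom_def)
  then have "d' n = d n" for n using d'(2) by (metis domIff not_None_eq)
  then have "d' = d" ..
  with d'(1) show "partial_computable_in g d" by simp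
qed

lemma ce_in_enum_apply:
  assumes W: "enumeration_operator W" and Y: "ce_in g Y"
  shows "ce_in g (enum_apply W Y)"
proof -
  define W' where "W' = (\<lambda>(F, k). prod_encode (set_encode F, k)) ` W"
  have fin: "finite F" if "(F, k) \<in> W" for F k
    using W that by (auto simp: enumeration_operator_def)
  have W'_iff: "prod_encode (c, k) \<in> W' \<longleftrightarrow> (set_decode c, k) \<in> W" for c k
    using fin by (force simp: W'_def prod_encode_eq)
  have "k \<in> enum_apply W Y \<longleftrightarrow>
      (\<exists>c. prod_encode (c, k) \<in> W' \<and> (\<forall>j<c. j \<in> set_decode c \<longrightarrow> j \<in> Y))" for k
  proof
    assume "k \<in> enum_apply W Y"
    then obtain F where F: "(F, k) \<in> W" "F \<subseteq> Y" unfolding enum_apply_def by blast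
    then show "\<exists>c. prod_encode (c, k) \<in> W' \<and> (\<forall>j<c. j \<in> set_decode c \<longrightarrow> j \<in> Y)"
      by (intro exI[of _ "set_encode F"]) (auto simp: W'_iff fin)
  next
    assume "\<exists>c. prod_encode (c, k) \<in> W' \<and> (\<forall>j<c. j \<in> set_decode c \<longrightarrow> j \<in> Y)"
    then show "k \<in> enum_apply W Y"
      unfolding W'_iff enum_apply_def using in_set_decode_less by blast
  qed
  moreover have "ce_in g W'"
    using W unfolding W'_def enumeration_operator_def by (blast intro: ce_in_if_ce)
  then have "semidecidable_in g (\<lambda>e. \<exists>c. prod_encode (c, e 0) \<in> W' \<and>
      (\<forall>j<c. j \<in> set_decode c \<longrightarrow> j \<in> Y))"
    by (intro semidecidable_in_ex semidecidable_in_conj semidecidable_in_all_less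
        semidecidable_in_imp semidecidable_in_mem[OF Y] semidecidable_in_mem recursive_intros)
  ultimately show ?thesis by (simp add: ce_in_iff_semidecidable_in)
qed

section \<open>Generic descriptions\<close>

lemma has_density_mono:
  assumes "has_density C 1" and "C \<subseteq> D"
  shows "has_density D 1"
  unfolding has_density_def
proof (rule tendsto_sandwich[where h = "\<lambda>_. 1"])
  show "(\<lambda>n. initial_density n C) \<longlonglongrightarrow> 1"
    using assms(1) by (simp add: has_density_def)
  have "card (C \<inter> {..<n}) \<le> card (D \<inter> {..<n})" for n
    using assms(2) by (intro card_mono) auto
  then show "\<forall>\<^sub>F n in sequentially. initial_density n C \<le> initial_density n D"
    by (simp add: initial_density_def divide_right_mono)
  have "card (D \<inter> {..<n}) \<le> n" for n
    using card_mono[of "{..<n}" "D \<inter> {..<n}"] by simp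
  then have "initial_density n D \<le> 1" for n
    by (cases "n = 0") (simp_all add: initial_density_def)
  then show "\<forall>\<^sub>F n in sequentially. initial_density n D \<le> 1"
    by simp
qed simp

lemma generic_descriptionD: "generic_description d g \<Longrightarrow> d n = Some y \<Longrightarrow> y = g n"
  using domI[of d n y] by (simp add: generic_description_def)

lemma generic_description_total: "generic_description (\<lambda>n. Some (g n)) g"
proof -
  have "\<forall>\<^sub>F n in sequentially. initial_density n UNIV = 1"
    by (rule eventually_sequentiallyI[of 1]) (simp add: initial_density_def)
  then have "has_density UNIV 1"
    unfolding has_density_def by (rule tendsto_eventually)
  then show ?thesis by (simp add: generic_description_def dom_def)
qed

lemma generically_computableI:
  assumes "semidecidable_in (\<lambda>_. 0) (\<lambda>e. R (e 0) (e 1))"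
    and "\<And>n y. R n y \<Longrightarrow> y = f n" and "has_density {n. \<exists>y. R n y} 1"
  shows "generically_computable f"
proof -
  obtain d where d: "partial_computable_in (\<lambda>_. 0) d" "\<And>n y. d n = Some y \<Longrightarrow> R n y"
      "dom d = {n. \<exists>y. R n y}"
    using semidecidable_in_selection[OF assms(1)] by blast
  have "d n = Some (f n)" if "n \<in> dom d" for n
    using that d(2) assms(2) by blast
  then have "generic_description d f"
    using assms(3) by (simp add: generic_description_def d(3))
  with d(1) show ?thesis
    unfolding generically_computable_def partial_computable_def by blast
qed

lemma partial_computable_in_if_ng_reducible:
  assumes "h \<le>\<^sub>n\<^sub>g g"
  shows "\<exists>e. partial_computable_in g e \<and> generic_description e h"
proof -
  obtain e W where e: "generic_description e h" and W: "enumeration_operator W"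
    and gra: "gra e = enum_apply W (gra (\<lambda>n. Some (g n)))"
    using assms generic_description_total unfolding ng_reducible_def by blast
  have "partial_computable_in g (\<lambda>n. Some (g n))"
    unfolding partial_computable_in_def by (rule exI[of _ Oracle]) simp
  then have "partial_computable_in g e"
    using ce_in_enum_apply[OF W] by (simp flip: ce_in_gra_iff add: gra)
  with e show ?thesis by blast
qed

lemma ng_reducible_if_ug_reducible: "h \<le>\<^sub>u\<^sub>g g \<Longrightarrow> h \<le>\<^sub>n\<^sub>g g"
  unfolding ug_reducible_def ng_reducible_def by blast

section \<open>Cylinders and initial segments\<close>

definition cylinder :: "nat set \<Rightarrow> nat \<Rightarrow> nat set set" where
  "cylinder X n = {Y. \<forall>i<n. i \<in> Y \<longleftrightarrow> i \<in> X}"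

lemma self_in_cylinder: "X \<in> cylinder X n"
  by (simp add: cylinder_def)

lemma ex_set_decode_in_cylinder: "\<exists>c. set_decode c \<in> cylinder X n"
  by (rule exI[of _ "set_encode (X \<inter> {..<n})"]) (simp add: cylinder_def)

lemma length_initial_segment [simp]: "length (initial_segment X n) = n"
  by (simp add: initial_segment_def)

lemma prefix_initial_segment_iff:
  "prefix (initial_segment X m) (initial_segment Y n) \<longleftrightarrow> m \<le> n \<and> Y \<in> cylinder X m"
proof -
  have "prefix (initial_segment X m) (initial_segment Y n) \<longleftrightarrow>
      m \<le> n \<and> take m (initial_segment Y n) = initial_segment X m"
    by (metis append_eq_conv_conj length_initial_segment prefix_def prefix_length_le take_is_prefix)
  also have "\<dots> \<longleftrightarrow> m \<le> n \<and> Y \<in> cylinder X m"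
    by (auto simp: initial_segment_def cylinder_def take_map)
  finally show ?thesis .
qed

lemma initial_segment_eq_iff:
  "initial_segment X m = initial_segment Y n \<longleftrightarrow> m = n \<and> Y \<in> cylinder X m"
proof (cases "m = n")
  case True
  then show ?thesis by (auto simp: initial_segment_def cylinder_def)
next
  case False
  then show ?thesis by (metis length_initial_segment)
qed

lemma ex_initial_segment_eq: "\<exists>X n. s = initial_segment X n"
  by (intro exI[of _ "{i. s ! i}"] exI[of _ "length s"]) (simp add: initial_segment_def map_nth)

lemma total_recursive_string_code_initial_segment [recursive_intros]:
  assumes "total_recursive g C" and "total_recursive g T"
  shows "total_recursive g (\<lambda>e. string_code (initial_segment (set_decode (C e)) (T e)))"
proof (rule total_recursive_comp2[OF _ assms])
  have suffix: "rec_nat 0 (\<lambda>j r. Suc (prod_encode (of_bool (n - Suc j \<in> X), r))) j =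
      string_code (map (\<lambda>i. i \<in> X) [n - j..<n])" if "j \<le> n" for j n X
    using that
  proof (induction j)
    case (Suc j)
    then have "[n - Suc j..<n] = (n - Suc j) # [n - j..<n]"
      by (simp add: upt_conv_Cons Suc_diff_Suc)
    then show ?case using Suc by (simp add: string_code_def)
  qed (simp add: string_code_def)
  have "total_recursive g (\<lambda>e. rec_nat 0
      (\<lambda>j r. Suc (prod_encode (of_bool (e 1 - Suc j \<in> set_decode (e 0)), r))) (e 1))"
    by (intro total_recursive_rec_nat recursive_intros)
  then show "total_recursive g (\<lambda>e. string_code (initial_segment (set_decode (e 0)) (e 1)))"
    by (simp add: suffix initial_segment_def)
qed

section \<open>Oracles that are 1-generic\<close>

lemma total_recursive_char_fun_set_decode:
  "total_recursive g (\<lambda>e. char_fun (set_decode (e 0)) (e 1))"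
  unfolding char_fun_def by (intro recursive_intros)

lemmas total_recursive_bounded_eval_set_decode [recursive_intros] =
  total_recursive_bounded_eval[OF total_recursive_char_fun_set_decode]

lemma bounded_eval_char_fun_cylinder:
  "Y \<in> cylinder X t \<Longrightarrow> bounded_eval (char_fun Y) t p xs = bounded_eval (char_fun X) t p xs"
  by (rule bounded_eval_cong) (simp add: cylinder_def char_fun_def)

definition disagreeing_strings :: "recfn \<Rightarrow> (nat \<Rightarrow> nat) \<Rightarrow> bool list set" where
  "disagreeing_strings p f =
     {initial_segment Y t | Y t. \<exists>n y. bounded_eval (char_fun Y) t p [n] = Suc y \<and> y \<noteq> f n}"

lemma initial_segment_in_disagreeing_strings_iff:
  "initial_segment Y t \<in> disagreeing_strings p f \<longleftrightarrow>
     (\<exists>n y. bounded_eval (char_fun Y) t p [n] = Suc y \<and> y \<noteq> f n)"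
  unfolding disagreeing_strings_def mem_Collect_eq initial_segment_eq_iff
  by (metis bounded_eval_char_fun_cylinder self_in_cylinder)

lemma ce_strings_in_disagreeing_strings: "ce_strings_in f (disagreeing_strings p f)"
proof -
  have "string_code ` disagreeing_strings p f =
      {z. \<exists>c t n y. z = string_code (initial_segment (set_decode c) t) \<and>
        bounded_eval (char_fun (set_decode c)) t p [n] = Suc y \<and> y \<noteq> f n}" (is "_ = ?Z")
  proof
    show "string_code ` disagreeing_strings p f \<subseteq> ?Z"
    proof
      fix z assume "z \<in> string_code ` disagreeing_strings p f"
      then obtain Y t n y where z: "z = string_code (initial_segment Y t)"
        and Y: "bounded_eval (char_fun Y) t p [n] = Suc y" "y \<noteq> f n"
        unfolding disagreeing_strings_def by auto
      obtain c where c: "set_decode c \<in> cylinder Y t" using ex_set_decode_in_cylinder by blast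
      then have "z = string_code (initial_segment (set_decode c) t)"
        using z by (metis initial_segment_eq_iff)
      moreover have "bounded_eval (char_fun (set_decode c)) t p [n] = Suc y"
        using Y(1) c by (simp add: bounded_eval_char_fun_cylinder)
      ultimately show "z \<in> ?Z" using Y(2) by blast
    qed
    show "?Z \<subseteq> string_code ` disagreeing_strings p f"
      unfolding disagreeing_strings_def by blast
  qed
  moreover have "semidecidable_in f (\<lambda>e. \<exists>c t n y.
      e 0 = string_code (initial_segment (set_decode c) t) \<and>
      bounded_eval (char_fun (set_decode c)) t p [n] = Suc y \<and> y \<noteq> f n)"
    by (intro semidecidable_in_ex semidecidable_in_if_decidable recursive_intros
        total_recursive_oracle)
  ultimately show ?thesis
    unfolding ce_strings_in_def ce_in_iff_semidecidable_in by simp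
qed

definition extension_computes :: "nat set \<Rightarrow> nat \<Rightarrow> recfn \<Rightarrow> nat \<Rightarrow> nat \<Rightarrow> bool" where
  "extension_computes X m p n y \<longleftrightarrow>
     (\<exists>Y t. m \<le> t \<and> Y \<in> cylinder X m \<and> bounded_eval (char_fun Y) t p [n] = Suc y)"

lemma semidecidable_in_extension_computes:
  "semidecidable_in g (\<lambda>e. extension_computes X m p (e 0) (e 1))"
proof -
  obtain x where x: "set_decode x \<in> cylinder X m" using ex_set_decode_in_cylinder by blast
  have "extension_computes X m p n y \<longleftrightarrow>
      (\<exists>c t. m \<le> t \<and> (\<forall>i<m. i \<in> set_decode c \<longleftrightarrow> i \<in> set_decode x) \<and>
        bounded_eval (char_fun (set_decode c)) t p [n] = Suc y)" (is "_ \<longleftrightarrow> ?C n y") for n y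
  proof
    assume "extension_computes X m p n y"
    then obtain Y t where t: "m \<le> t" and Y: "Y \<in> cylinder X m"
      and y: "bounded_eval (char_fun Y) t p [n] = Suc y"
      unfolding extension_computes_def by blast
    obtain c where c: "set_decode c \<in> cylinder Y t" using ex_set_decode_in_cylinder by blast
    have "\<forall>i<m. i \<in> set_decode c \<longleftrightarrow> i \<in> set_decode x"
      using c t Y x by (simp add: cylinder_def)
    moreover have "bounded_eval (char_fun (set_decode c)) t p [n] = Suc y"
      using c y by (simp add: bounded_eval_char_fun_cylinder)
    ultimately show "?C n y" using t by blast
  next
    assume "?C n y"
    then show "extension_computes X m p n y"
      using x unfolding extension_computes_def cylinder_def by auto
  qed
  then show ?thesis
    by (simp only:) (intro semidecidable_in_ex semidecidable_in_if_decidable recursive_intros)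
qed

lemma extension_computes_if_run:
  assumes "run (char_fun X) p [n] = Some y"
  shows "extension_computes X m p n y"
proof -
  have "\<forall>\<^sub>F t in sequentially. m \<le> t \<and> bounded_eval (char_fun X) t p [n] = Suc y"
    using eventually_ge_at_top bounded_eval_complete[OF assms] by (rule eventually_conj)
  from eventually_happens'[OF sequentially_bot this] show ?thesis
    unfolding extension_computes_def using self_in_cylinder by blast
qed

lemma generically_computable_if_extensions_agree:
  assumes desc: "generic_description (\<lambda>n. run (char_fun X) p [n]) f"
    and agree: "\<And>s. prefix (initial_segment X m) s \<Longrightarrow> s \<notin> disagreeing_strings p f"
  shows "generically_computable f"
proof (rule generically_computableI)
  show "semidecidable_in (\<lambda>_. 0) (\<lambda>e. extension_computes X m p (e 0) (e 1))"
    by (rule semidecidable_in_extension_computes)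
  show "y = f n" if "extension_computes X m p n y" for n y
  proof -
    obtain Y t where "m \<le> t" and "Y \<in> cylinder X m"
      and y: "bounded_eval (char_fun Y) t p [n] = Suc y"
      using \<open>extension_computes X m p n y\<close> unfolding extension_computes_def by blast
    then have "initial_segment Y t \<notin> disagreeing_strings p f"
      by (intro agree) (simp add: prefix_initial_segment_iff)
    then show ?thesis
      using y unfolding initial_segment_in_disagreeing_strings_iff by blast
  qed
  have "dom (\<lambda>n. run (char_fun X) p [n]) \<subseteq> {n. \<exists>y. extension_computes X m p n y}"
    using extension_computes_if_run by blast
  then show "has_density {n. \<exists>y. extension_computes X m p n y} 1"
    using desc unfolding generic_description_def by (blast intro: has_density_mono)
qed

lemma one_generic_computes_no_generic_description:
  assumes f: "\<not> generically_computable f" and X: "one_generic_in f X"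
    and d: "partial_computable_in (char_fun X) d"
  shows "\<not> generic_description d f"
proof
  assume desc: "generic_description d f"
  obtain p where p: "d = (\<lambda>n. run (char_fun X) p [n])"
    using d unfolding partial_computable_in_def by blast
  have "initial_segment X m \<notin> disagreeing_strings p f" for m
    using generic_descriptionD[OF desc] bounded_eval_sound
    unfolding initial_segment_in_disagreeing_strings_iff p by blast
  then obtain m where "\<And>s. prefix (initial_segment X m) s \<Longrightarrow> s \<notin> disagreeing_strings p f"
    using X ce_strings_in_disagreeing_strings[of f p] unfolding one_generic_in_def by blast
  then have "generically_computable f"
    by (rule generically_computable_if_extensions_agree[OF desc[unfolded p]])
  with f show False by contradiction
qed

section \<open>Meagerness in Cantor space\<close>

lemma openin_cantor_space_iff:
  "openin cantor_space U \<longleftrightarrow>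
     (\<exists>V. openin (product_topology (\<lambda>_. discrete_topology UNIV) UNIV) V \<and> U = (\<lambda>X n. n \<in> X) -` V)"
  unfolding cantor_space_def openin_pullback_topology by simp

lemma topspace_cantor_space: "topspace cantor_space = UNIV"
  unfolding cantor_space_def topspace_pullback_topology by simp

lemma openin_cylinder: "openin cantor_space (cylinder X n)"
  unfolding openin_cantor_space_iff
proof (intro exI conjI)
  let ?B = "\<lambda>i. if i < n then {i \<in> X} else UNIV"
  show "openin (product_topology (\<lambda>_. discrete_topology UNIV) UNIV) (Pi\<^sub>E UNIV ?B)"
  proof (rule product_topology_basis)
    show "finite {i. ?B i \<noteq> topspace (discrete_topology UNIV)}"
      by (rule finite_subset[of _ "{..<n}"]) (auto split: if_splits)
  qed simp
  show "cylinder X n = (\<lambda>X n. n \<in> X) -` Pi\<^sub>E UNIV ?B"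
    by (auto simp: cylinder_def PiE_UNIV_domain split: if_splits)
qed

lemma cylinder_subset_if_openin:
  assumes "openin cantor_space U" and "X \<in> U"
  shows "\<exists>n. cylinder X n \<subseteq> U"
proof -
  obtain V where V: "openin (product_topology (\<lambda>_. discrete_topology UNIV) UNIV) V"
    and U: "U = (\<lambda>X n. n \<in> X) -` V"
    using assms(1) unfolding openin_cantor_space_iff by blast
  have "(\<lambda>n. n \<in> X) \<in> V" using assms(2) U by simp
  from product_topology_open_contains_basis[OF V this]
  obtain B where X: "(\<lambda>n. n \<in> X) \<in> Pi\<^sub>E UNIV B" and fin: "finite {i. B i \<noteq> UNIV}"
    and B: "Pi\<^sub>E UNIV B \<subseteq> V"
    by auto
  obtain n where n: "{i. B i \<noteq> UNIV} \<subseteq> {..<n}"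
    using fin finite_nat_iff_bounded by blast
  have "Y \<in> U" if Y: "Y \<in> cylinder X n" for Y
  proof -
    have "(i \<in> Y) \<in> B i" for i
    proof (cases "i < n")
      case True
      then show ?thesis using X Y by (auto simp: cylinder_def PiE_UNIV_domain)
    next
      case False
      then show ?thesis using n by auto
    qed
    then have "(\<lambda>i. i \<in> Y) \<in> Pi\<^sub>E UNIV B" by (simp add: PiE_UNIV_domain)
    then show ?thesis using B U by blast
  qed
  then show ?thesis by blast
qed

lemma nowhere_dense_in_frontier_of_openin:
  assumes "openin T U"
  shows "nowhere_dense_in T (T frontier_of U)"
proof -
  let ?I = "T interior_of (T frontier_of U)"
  have "?I \<subseteq> T closure_of U - U"
    using interior_of_subset frontier_of_openin[OF assms] by metis
  moreover from this have "?I \<inter> T closure_of U = {}"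
    by (subst openin_Int_closure_of_eq_empty) auto
  ultimately have "?I = {}" by blast
  then show ?thesis
    by (simp add: nowhere_dense_in_def frontier_of_subset_topspace closure_of_closedin
        closedin_frontier_of)
qed

definition meeting_sets :: "bool list set \<Rightarrow> nat set set" where
  "meeting_sets S = {X. \<exists>n. initial_segment X n \<in> S}"

lemma openin_meeting_sets: "openin cantor_space (meeting_sets S)"
proof (subst openin_subopen, intro ballI)
  fix X assume "X \<in> meeting_sets S"
  then obtain n where n: "initial_segment X n \<in> S" unfolding meeting_sets_def by blast
  have "Y \<in> meeting_sets S" if "Y \<in> cylinder X n" for Y
  proof -
    have "initial_segment X n = initial_segment Y n"
      using that by (simp add: initial_segment_eq_iff)
    with n show ?thesis unfolding meeting_sets_def by auto
  qed
  then show "\<exists>T. openin cantor_space T \<and> X \<in> T \<and> T \<subseteq> meeting_sets S"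
    by (intro exI[of _ "cylinder X n"]) (auto simp: openin_cylinder self_in_cylinder)
qed

lemma in_frontier_of_meeting_sets:
  assumes avoid: "\<And>n. initial_segment X n \<notin> S"
    and dense: "\<And>n. \<exists>s\<in>S. prefix (initial_segment X n) s"
  shows "X \<in> cantor_space frontier_of (meeting_sets S)"
proof -
  have "\<exists>Y\<in>meeting_sets S. Y \<in> U" if U: "openin cantor_space U" "X \<in> U" for U
  proof -
    obtain n where n: "cylinder X n \<subseteq> U" using cylinder_subset_if_openin[OF U] ..
    obtain s where s: "s \<in> S" "prefix (initial_segment X n) s" using dense by blast
    obtain Y m where "s = initial_segment Y m" using ex_initial_segment_eq by blast
    then have "Y \<in> cylinder X n" and "Y \<in> meeting_sets S"
      unfolding meeting_sets_def using s by (auto simp: prefix_initial_segment_iff)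
    then show ?thesis using n by blast
  qed
  then have "X \<in> cantor_space closure_of (meeting_sets S)"
    by (simp add: in_closure_of topspace_cantor_space Bex_def)
  then show ?thesis
    using avoid openin_meeting_sets by (simp add: frontier_of_openin meeting_sets_def)
qed

lemma countable_ce_strings_in: "countable {S. ce_strings_in f S}"
proof (rule countable_image_inj_on)
  have "inj (of_bool :: bool \<Rightarrow> nat)" by (simp add: inj_def)
  then have "inj string_code"
    by (intro injI) (simp add: string_code_def list_encode_eq inj_map_eq_map)
  then show "inj_on (image string_code) {S. ce_strings_in f S}"
    by (simp add: inj_image_eq_iff inj_on_def)
  show "countable (image string_code ` {S. ce_strings_in f S})"
    by (rule countable_subset[OF _ countable_ce_in[of f]]) (auto simp: ce_strings_in_def)
qed

lemma nowhere_dense_in_subset: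
  assumes "nowhere_dense_in T S" and "R \<subseteq> S"
  shows "nowhere_dense_in T R"
  using assms interior_of_mono[OF closure_of_mono[OF assms(2)], of T T]
  unfolding nowhere_dense_in_def by blast

lemma meager_in_subset:
  assumes "meager_in T S" and "R \<subseteq> S"
  shows "meager_in T R"
proof -
  obtain U :: "nat \<Rightarrow> _" where U: "\<forall>i. nowhere_dense_in T (U i)" "S = (\<Union>i. U i)"
    using assms(1) unfolding meager_in_def by blast
  have "\<forall>i. nowhere_dense_in T (R \<inter> U i)"
    using U(1) by (blast intro: nowhere_dense_in_subset)
  moreover have "R = (\<Union>i. R \<inter> U i)" using U(2) assms(2) by blast
  ultimately show ?thesis
    unfolding meager_in_def by (intro exI[of _ "\<lambda>i. R \<inter> U i"] conjI)
qed

lemma meager_in_UN: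
  assumes I: "countable I" and N: "\<And>i. i \<in> I \<Longrightarrow> nowhere_dense_in T (N i)"
  shows "meager_in T (\<Union>i\<in>I. N i)"
proof -
  define U where "U j = (if j \<in> to_nat_on I ` I then N (from_nat_into I j) else {})" for j
  have U: "U (to_nat_on I i) = N i" if "i \<in> I" for i
    using that I by (simp add: U_def)
  have "nowhere_dense_in T {}" by (simp add: nowhere_dense_in_def)
  then have "\<forall>j. nowhere_dense_in T (U j)"
    using I N by (auto simp: U_def)
  moreover have "(\<Union>i\<in>I. N i) = (\<Union>j. U j)"
  proof
    show "(\<Union>i\<in>I. N i) \<subseteq> (\<Union>j. U j)" using U by blast
    show "(\<Union>j. U j) \<subseteq> (\<Union>i\<in>I. N i)" using I by (auto simp: U_def split: if_splits)
  qed
  ultimately show ?thesis unfolding meager_in_def by (intro exI[of _ U] conjI)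
qed

lemma meager_in_not_one_generic: "meager_in cantor_space {X. \<not> one_generic_in f X}"
proof (rule meager_in_subset)
  show "meager_in cantor_space
      (\<Union>S\<in>{S. ce_strings_in f S}. cantor_space frontier_of (meeting_sets S))"
    by (intro meager_in_UN countable_ce_strings_in nowhere_dense_in_frontier_of_openin
        openin_meeting_sets)
  show "{X. \<not> one_generic_in f X} \<subseteq>
      (\<Union>S\<in>{S. ce_strings_in f S}. cantor_space frontier_of (meeting_sets S))"
  proof
    fix X assume "X \<in> {X. \<not> one_generic_in f X}"
    then obtain S where S: "ce_strings_in f S" "\<And>n. initial_segment X n \<notin> S"
        "\<And>n. \<exists>s\<in>S. prefix (initial_segment X n) s"
      unfolding one_generic_in_def by auto
    from S(2,3) have "X \<in> cantor_space frontier_of (meeting_sets S)"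
      by (rule in_frontier_of_meeting_sets)
    with S(1) show "X \<in> (\<Union>S\<in>{S. ce_strings_in f S}. cantor_space frontier_of (meeting_sets S))"
      by blast
  qed
qed

lemma not_one_generic_if_ng_reducible:
  assumes "\<not> generically_computable f" and "f \<le>\<^sub>n\<^sub>g char_fun X"
  shows "\<not> one_generic_in f X"
  using assms partial_computable_in_if_ng_reducible one_generic_computes_no_generic_description
  by blast

theorem theorem6p8:
  shows "(\<forall>(f :: nat \<Rightarrow> nat) (X :: nat set).
            \<not> generically_computable f \<longrightarrow> one_generic_in f X \<longrightarrow>
            \<not> (\<exists>d. partial_computable_in (char_fun X) d \<and> generic_description d f)) \<and>
         (\<forall>A :: nat set. \<not> generically_computable (char_fun A) \<longrightarrow>
            meager_in cantor_space {X. char_fun A \<le>\<^sub>u\<^sub>g char_fun X} \<and>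
            meager_in cantor_space {X. char_fun A \<le>\<^sub>n\<^sub>g char_fun X})"
proof (intro conjI allI impI)
  show "\<not> (\<exists>d. partial_computable_in (char_fun X) d \<and> generic_description d f)"
    if "\<not> generically_computable f" and "one_generic_in f X" for f X
    using one_generic_computes_no_generic_description[OF that] by blast
next
  fix A assume A: "\<not> generically_computable (char_fun A)"
  have "{X. char_fun A \<le>\<^sub>n\<^sub>g char_fun X} \<subseteq> {X. \<not> one_generic_in (char_fun A) X}"
    using not_one_generic_if_ng_reducible[OF A] by blast
  with meager_in_not_one_generic
  show ng: "meager_in cantor_space {X. char_fun A \<le>\<^sub>n\<^sub>g char_fun X}"
    by (rule meager_in_subset)
  have "{X. char_fun A \<le>\<^sub>u\<^sub>g char_fun X} \<subseteq> {X. char_fun A \<le>\<^sub>n\<^sub>g char_fun X}"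
    using ng_reducible_if_ug_reducible by blast
  with ng show "meager_in cantor_space {X. char_fun A \<le>\<^sub>u\<^sub>g char_fun X}"
    by (rule meager_in_subset)
qed

end
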